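(* Let $p$ be a prime, $t\ge 1$, $q=p^t$. Let $H$ be a Hermitian unital embedded in $\operatorname{PG}(2,q^2)$ and let $U$ be any other unital embedded in $\operatorname{PG}(2,q^2)$. Then $$|H\cap U|\equiv 1 \pmod{p^{\lceil t/2\rceil}}.$$ Moreover, if $U$ is a Buekenhout–Metz unital, then $$|H\cap U|\equiv 1 \pmod{q}.$$
   Context: A unital embedded in the projective plane $\operatorname{PG}(2,q^2)$ is a set of $q^3+1$ points such that every line of the plane meets it in exactly $1$ or $q+1$ points. A Hermitian (classical) unital is the set of projective points where a nondegenerate Hermitian (unitary) form on $\mathbb{F}_{q^2}^3$ vanishes; every such set is projectively equivalent to $\{\langle(x,y,z)\rangle : x^{q+1}+y^{q+1}+z^{q+1}=0\}$. A Buekenhout–Metz unital is a unital in $\operatorname{PG}(2,q^2)$ projectively equivalent to a set of the form $$U_{\alpha,\beta}=\{\langle(1,y,\alpha y^2+\beta y^{q+1}+r)\rangle : y\in\mathbb{F}_{q^2},\ r\in\mathbb{F}_q\}\cup\{\langle(0,0,1)\rangle\}$$ for some $\alpha,\beta\in\mathbb{F}_{q^2}$ (for which this set is a unital; for $\alpha\neq 0$ this holds iff $(\beta^q-\beta)^2+4\alpha^{q+1}$ is a nonsquare in $\mathbb{F}_q$ when $q$ is odd, resp. $\operatorname{Tr}_{\mathbb{F}_q/\mathbb{F}_2}\big((\beta^q+\beta)/\alpha^{q+1}\big)=1$ when $q$ is even). *)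

theory Defs
  imports "HOL-Analysis.Determinants" "HOL-Number_Theory.Cong"
begin

definition proj_pt :: "'a::field ^ 3 \<Rightarrow> ('a ^ 3) set" where
  "proj_pt v = {c *s v | c. c \<noteq> 0}"

definition proj_points :: "('a::field ^ 3) set set" where
  "proj_points = {proj_pt v | v. v \<noteq> 0}"

definition proj_line :: "'a::field ^ 3 \<Rightarrow> ('a ^ 3) set set" where
  "proj_line w = {proj_pt v | v. v \<noteq> 0 \<and> (\<Sum>i\<in>UNIV. w $ i * v $ i) = 0}"

definition proj_lines :: "('a::field ^ 3) set set set" where
  "proj_lines = {proj_line w | w. w \<noteq> 0}"

text \<open>A unital of PG(2,q^2) (the field is assumed to have q^2 elements).\<close>
definition is_unital :: "nat \<Rightarrow> ('a::field ^ 3) set set \<Rightarrow> bool" where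
  "is_unital q U \<longleftrightarrow> U \<subseteq> proj_points \<and> card U = q ^ 3 + 1 \<and>
     (\<forall>L\<in>proj_lines. card (L \<inter> U) = 1 \<or> card (L \<inter> U) = q + 1)"

definition herm_form :: "nat \<Rightarrow> 'a::field ^ 3 ^ 3 \<Rightarrow> 'a ^ 3 \<Rightarrow> 'a ^ 3 \<Rightarrow> 'a" where
  "herm_form q M u v = (\<Sum>i\<in>UNIV. \<Sum>j\<in>UNIV. u $ i * M $ i $ j * (v $ j) ^ q)"

definition is_hermitian_matrix :: "nat \<Rightarrow> 'a::field ^ 3 ^ 3 \<Rightarrow> bool" where
  "is_hermitian_matrix q M \<longleftrightarrow> (\<forall>i j. M $ j $ i = (M $ i $ j) ^ q)"

definition is_hermitian_unital :: "nat \<Rightarrow> ('a::field ^ 3) set set \<Rightarrow> bool" where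
  "is_hermitian_unital q H \<longleftrightarrow> (\<exists>M. is_hermitian_matrix q M \<and> det M \<noteq> 0 \<and>
     H = {proj_pt v | v. v \<noteq> 0 \<and> herm_form q M v v = 0})"

definition BM_vecs :: "nat \<Rightarrow> 'a::field \<Rightarrow> 'a \<Rightarrow> ('a ^ 3) set" where
  "BM_vecs q \<alpha> \<beta> =
     {vector [1, y, \<alpha> * y ^ 2 + \<beta> * y ^ (q + 1) + r] | y r. r ^ q = r}
     \<union> {vector [0, 0, 1]}"

definition BM_set :: "nat \<Rightarrow> 'a::field \<Rightarrow> 'a \<Rightarrow> ('a ^ 3) set set" where
  "BM_set q \<alpha> \<beta> = proj_pt ` BM_vecs q \<alpha> \<beta>"

definition is_BM_unital :: "nat \<Rightarrow> ('a::field ^ 3) set set \<Rightarrow> bool" where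
  "is_BM_unital q U \<longleftrightarrow> is_unital q U \<and>
     (\<exists>\<alpha> \<beta> A. invertible A \<and> U = {proj_pt (A *v v) | v. v \<in> BM_vecs q \<alpha> \<beta>})"

end

theory Submission
  imports Defs "HOL-Computational_Algebra.Polynomial"
begin

text \<open>
  Diagonalise the Hermitian form as \<open>\<Sum> d\<^sub>i N(x\<^sub>i)\<close> and let \<open>h(d)\<close> be the number of points of \<open>U\<close> off
  the Hermitian curve with coefficients \<open>d\<close> in the torus \<open>(F\<^sub>q\<^sup>*)\<^sup>3\<close>. A Hasse--Davenport type identity,
  proved by elementary counting modulo \<open>q\<close>, expresses the multiplicative convolution \<open>h * h\<close> through
  the numbers of points of \<open>U\<close> off lines, all divisible by \<open>q\<close>; hence \<open>q\<close> divides \<open>h * h\<close>. As the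
  group algebra of the torus is reduced modulo \<open>p\<close>, roughly half of the \<open>p\<close>-adic valuation survives
  the extraction of the square root: \<open>p\<^bsup>\<lceil>t/2\<rceil>\<^esup>\<close> divides \<open>h\<close>.

  For a Buekenhout--Metz unital with special point on \<open>H\<close>, the equation of \<open>H\<close> is linear in \<open>r\<close> and
  the count is immediate. If the special point is off \<open>H\<close> and \<open>q > 2\<close>, the points of \<open>H \<inter> U\<close> are the common zeros of two
  quadratic polynomials in four variables over \<open>F\<^sub>q\<close>. Averaging over the pencil they span reduces the
  count modulo \<open>q\<close> to affine conics, whose number of points modulo \<open>q\<close> only depends on the quadratic
  part; that part is controlled by an anisotropic form. For \<open>q = p\<close> the first congruence suffices.
\<close>

subsection \<open>Quadratic extensions of finite fields\<close>

text \<open>Multiplication by a nonzero \<open>x\<close> permutes the nonzero elements, so their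
  product absorbs the factor \<open>x ^ (CARD('a) - 1)\<close>.\<close>

lemma finite_field_power_card:
  fixes x :: "'a::{finite,field}"
  shows "x ^ CARD('a) = x"
proof (cases "x = 0")
  case False
  have "x * (\<Prod>y\<in>UNIV-{0}. x * y) = x * x ^ (CARD('a) - 1) * \<Prod>(UNIV-{0})"
    by (simp add: prod.distrib mult_ac card_Diff_singleton)
  also have "x * x ^ (CARD('a) - 1) = x ^ CARD('a)"
    by (metis One_nat_def Suc_pred power_Suc zero_less_card_finite)
  also have "(\<Prod>y\<in>UNIV-{0}. x * y) = (\<Prod>y\<in>UNIV-{0}. y)"
    by (rule prod.reindex_bij_witness[of _ "\<lambda>y. y / x" "\<lambda>y. x * y"]) (use False in auto)
  finally show ?thesis by simp
qed auto

text \<open>Translation by 1 permutes the field; comparing sums shows that the characteristic,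
  itself a prime, divides \<open>p ^ n\<close>.\<close>

lemma CHAR_eq_of_card_prime_power:
  assumes "prime p" and "CARD('a::{finite,field}) = p ^ n"
  shows "CHAR('a) = p"
proof -
  have "(\<Sum>x\<in>UNIV. x + 1 :: 'a) = (\<Sum>x\<in>UNIV. x)"
    by (rule sum.reindex_bij_witness[of _ "\<lambda>y. y - 1" "\<lambda>y. y + 1"]) auto
  then have "of_nat CARD('a) = (0::'a)"
    by (simp add: sum.distrib)
  then have "CHAR('a) dvd p ^ n"
    unfolding assms(2) of_nat_eq_0_iff_char_dvd .
  then obtain i where "CHAR('a) = p ^ i"
    using divides_primepow_nat[OF assms(1)] by blast
  moreover have "prime CHAR('a)"
    by (rule prime_CHAR_semidom) (rule finite_imp_CHAR_pos, simp)
  ultimately show ?thesis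
    by (simp add: prime_power_iff)
qed

lemma card_fibres:
  assumes "finite A" and "finite B" and "f ` A \<subseteq> B"
  shows "card A = (\<Sum>b\<in>B. card {x\<in>A. f x = b})"
  using assms by (simp add: card_eq_sum sum.group del: sum_constant)

text \<open>Equality case of an averaging argument: it turns upper bounds on numbers of roots,
  together with a known total, into exact fibre sizes.\<close>

lemma sum_upper_bound_eqD:
  fixes f :: "'b \<Rightarrow> nat"
  assumes "finite B" and "\<And>b. b \<in> B \<Longrightarrow> f b \<le> m" and "sum f B \<ge> m * card B" and "b \<in> B"
  shows "f b = m"
proof (rule ccontr)
  assume "f b \<noteq> m"
  then have "f b < m" using assms(2,4) by (simp add: order_less_le)
  then have "sum f B < (\<Sum>b\<in>B. m)" using assms(1,2,4) by (meson sum_strict_mono_ex1)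
  then show False using assms(3) by (simp add: mult.commute)
qed

locale quadratic_extension =
  fixes p t q :: nat and F :: "'a::{finite,field} itself"
  assumes prime_p: "prime p" and t_pos: "t \<ge> 1" and q_eq: "q = p ^ t"
    and card_F: "CARD('a) = q ^ 2"
begin

text \<open>\<open>K\<close> is the subfield with \<open>q\<close> elements, \<open>cj\<close> the
  conjugation over it, \<open>nrm\<close> and \<open>tr\<close> the relative norm and trace.\<close>

definition K :: "'a set" where "K = {x. x ^ q = x}"
definition cj :: "'a \<Rightarrow> 'a" where "cj x = x ^ q"
definition nrm :: "'a \<Rightarrow> 'a" where "nrm x = x * cj x"
definition tr :: "'a \<Rightarrow> 'a" where "tr x = x + cj x"
abbreviation K' :: "'a set" where "K' \<equiv> K - {0}"

lemma q_gt_1: "q > 1"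
  using prime_gt_1_nat[OF prime_p] t_pos unfolding q_eq by (intro one_less_power) auto

lemma q_pos: "q > 0" using q_gt_1 by simp

lemma CHAR_F: "CHAR('a) = p"
  by (rule CHAR_eq_of_card_prime_power[OF prime_p, of "t * 2"])
     (simp add: card_F q_eq power_mult)

lemma of_nat_q [simp]: "of_nat q = (0::'a)"
  using t_pos by (simp add: of_nat_eq_0_iff_char_dvd CHAR_F q_eq)

lemma cj_add [simp]: "cj (x + y) = cj x + cj y"
  unfolding cj_def by (rule freshmans_dream'[of _ t]) (use prime_p q_eq CHAR_F in auto)

lemma cj_mult [simp]: "cj (x * y) = cj x * cj y"
  by (simp add: cj_def power_mult_distrib)

lemma cj_0 [simp]: "cj 0 = 0" and cj_1 [simp]: "cj 1 = 1"
  using q_pos by (auto simp: cj_def)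

lemma cj_minus [simp]: "cj (- x) = - cj x"
  using cj_add[of x "- x"] by (simp add: eq_neg_iff_add_eq_0 add.commute)

lemma cj_diff [simp]: "cj (x - y) = cj x - cj y"
  using cj_add[of x "- y"] by simp

lemma cj_divide [simp]: "cj (x / y) = cj x / cj y"
  by (simp add: cj_def power_divide)

lemma cj_power [simp]: "cj (x ^ n) = cj x ^ n"
  by (simp add: cj_def flip: power_mult) (simp add: mult.commute)

lemma cj_cj [simp]: "cj (cj x) = x"
  using finite_field_power_card[of x]
  by (simp add: cj_def card_F flip: power_mult) (simp add: power2_eq_square)

lemma cj_eq_0_iff [simp]: "cj x = 0 \<longleftrightarrow> x = 0"
  using q_pos by (simp add: cj_def)

lemma mem_K_iff: "x \<in> K \<longleftrightarrow> cj x = x"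
  by (simp add: K_def cj_def)

lemma cj_K [simp]: "x \<in> K \<Longrightarrow> cj x = x"
  by (simp add: mem_K_iff)

lemma K_intros [simp]:
  "0 \<in> K" "1 \<in> K" "nrm z \<in> K" "tr z \<in> K"
  "x \<in> K \<Longrightarrow> y \<in> K \<Longrightarrow> x + y \<in> K"
  "x \<in> K \<Longrightarrow> y \<in> K \<Longrightarrow> x - y \<in> K"
  "x \<in> K \<Longrightarrow> y \<in> K \<Longrightarrow> x * y \<in> K"
  "x \<in> K \<Longrightarrow> y \<in> K \<Longrightarrow> x / y \<in> K"
  "x \<in> K \<Longrightarrow> - x \<in> K"
  by (auto simp: mem_K_iff nrm_def tr_def mult.commute add.commute simp del: cj_K)

lemma nrm_mult: "nrm (x * y) = nrm x * nrm y"
  by (simp add: nrm_def)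

lemma nrm_divide: "nrm (x / y) = nrm x / nrm y"
  by (simp add: nrm_def)

lemma nrm_eq_0_iff [simp]: "nrm x = 0 \<longleftrightarrow> x = 0"
  by (simp add: nrm_def)

lemma nrm_0 [simp]: "nrm 0 = 0" by simp

lemma nrm_minus [simp]: "nrm (- x) = nrm x"
  by (simp add: nrm_def)

lemma nrm_cj [simp]: "nrm (cj x) = nrm x"
  by (simp add: nrm_def)

lemma tr_scale: "c \<in> K \<Longrightarrow> tr (c * x) = c * tr x"
  by (simp add: tr_def algebra_simps)

lemma power_q_plus_1: "x ^ (q + 1) = nrm x"
  by (simp add: nrm_def cj_def)

lemma nrm_add: "nrm (x + y) = nrm x + nrm y + tr (x * cj y)"
  by (simp add: nrm_def tr_def algebra_simps)

lemma finite_F [simp]: "finite (A :: 'a set)" by simp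

section \<open>Fibre sizes of norm and trace\<close>

lemma card_roots_monic:
  fixes P :: "'a poly"
  assumes "degree P = n" and "P \<noteq> 0"
  shows "card {x. poly P x = 0} \<le> n"
  using card_poly_roots_bound[OF assms(2)] assms(1) by simp

text \<open>The roots of \<open>X ^ (q - 1) - 1\<close> and of \<open>X ^ (q + 1) - c\<close> bound
  the two cardinalities from above. The norm fibres over \<open>K'\<close> partition the
  \<open>(q + 1) * (q - 1)\<close> nonzero elements, which forces equality in both bounds.\<close>

lemma card_K_nonzero: "card K' = q - 1"
  and card_nrm_fibre: "c \<in> K' \<Longrightarrow> card {x. nrm x = c} = q + 1"
proof -
  have K'_le: "card K' \<le> q - 1"
  proof -
    let ?P = "monom 1 (q - 1) + [:- 1:] :: 'a poly"
    have "degree ?P = q - 1"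
      using q_gt_1 by (subst degree_add_eq_left) (auto simp: degree_monom_eq)
    moreover have "?P \<noteq> 0"
      using calculation q_gt_1 by (metis degree_0 zero_less_diff less_numeral_extra(3))
    moreover have "K' \<subseteq> {x. poly ?P x = 0}"
    proof
      fix x assume "x \<in> K'"
      then have "x * x ^ (q - 1) = x" "x \<noteq> 0"
        using q_pos by (auto simp: K_def simp flip: power_Suc)
      then show "x \<in> {x. poly ?P x = 0}" by (simp add: poly_monom)
    qed
    ultimately show ?thesis
      by (intro order_trans[OF card_mono[OF finite_F] card_roots_monic])
  qed
  have fib_le: "card {x. nrm x = c} \<le> q + 1" for c
  proof -
    let ?P = "monom 1 (q + 1) + [:- c:] :: 'a poly"
    have d: "degree ?P = q + 1"
      by (subst degree_add_eq_left) (auto simp: degree_monom_eq)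
    moreover have "?P \<noteq> 0"
      using d by (metis degree_0 add_is_0 one_neq_zero)
    moreover have "{x. nrm x = c} = {x. poly ?P x = 0}"
      using power_q_plus_1 by (simp add: poly_monom)
    ultimately show ?thesis using card_roots_monic[of ?P] by simp
  qed
  have "card (UNIV - {0::'a}) = (\<Sum>c\<in>K'. card {x \<in> UNIV - {0}. nrm x = c})"
    by (rule card_fibres) auto
  also have "\<dots> = (\<Sum>c\<in>K'. card {x. nrm x = c})"
    by (intro sum.cong refl arg_cong[where f = card]) auto
  finally have tot: "(\<Sum>c\<in>K'. card {x. nrm x = c}) = q ^ 2 - 1"
    by (simp add: card_Diff_singleton card_F)
  have sq: "q ^ 2 - 1 = (q + 1) * (q - 1)"
    by (cases q) (auto simp: power2_eq_square)
  have "(\<Sum>c\<in>K'. card {x. nrm x = c}) \<le> (q + 1) * card K'"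
    using sum_bounded_above[of K' "\<lambda>c. card {x. nrm x = c}" "q + 1"] fib_le by (simp add: mult.commute)
  then have "(q + 1) * (q - 1) \<le> (q + 1) * card K'"
    using tot sq by simp
  then have "q - 1 \<le> card K'"
    by (simp only: nat_mult_le_cancel_disj)
  with K'_le show e: "card K' = q - 1" by simp
  show "card {x. nrm x = c} = q + 1" if "c \<in> K'"
    using sum_upper_bound_eqD[of K' "\<lambda>c. card {x. nrm x = c}" "q + 1" c] fib_le that tot sq e by simp
qed

lemma card_K: "card K = q"
proof -
  have "card K = Suc (card K')" by (rule card.remove) auto
  then show ?thesis using card_K_nonzero q_pos by simp
qed

text \<open>The fibre consists of roots of \<open>X ^ q + X - c\<close>, hence has at most
  \<open>q\<close> elements, while \<open>q\<close> fibres have to cover \<open>q ^ 2\<close>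
  elements.\<close>

lemma card_tr_fibre:
  assumes "c \<in> K"
  shows "card {x. tr x = c} = q"
proof -
  have le: "card {x. tr x = c} \<le> q" for c
  proof -
    let ?P = "monom 1 q + [:-c, 1:] :: 'a poly"
    have d: "degree ?P = q"
      using q_gt_1 by (subst degree_add_eq_left) (auto simp: degree_monom_eq)
    moreover have "?P \<noteq> 0"
      using d q_pos by (metis degree_0 less_numeral_extra(3))
    moreover have "{x. tr x = c} = {x. poly ?P x = 0}"
      by (auto simp: poly_monom tr_def cj_def algebra_simps)
    ultimately show ?thesis using card_roots_monic[of ?P] by simp
  qed
  have "card (UNIV::'a set) = (\<Sum>c\<in>K. card {x \<in> UNIV. tr x = c})"
    by (rule card_fibres) auto
  then have "(\<Sum>c\<in>K. card {x. tr x = c}) = q * card K"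
    by (simp add: card_F card_K power2_eq_square)
  then show ?thesis
    using sum_upper_bound_eqD[of K "\<lambda>c. card {x. tr x = c}" q c] le assms by simp
qed

lemma card_tr_scaled_fibre:
  assumes "c \<in> K" and "a \<noteq> 0"
  shows "card {x. tr (a * x) = c} = q"
proof -
  have "bij_betw (\<lambda>x. a * x) {x. tr (a * x) = c} {x. tr x = c}"
    by (rule bij_betw_byWitness[where f' = "\<lambda>x. x / a"]) (use assms in auto)
  then show ?thesis using card_tr_fibre[OF assms(1)] bij_betw_same_card by fastforce
qed

lemma card_quadratic_roots_le: "card {x::'a. x ^ 2 - a * x + b = 0} \<le> 2"
proof -
  have "card {x. poly [:b, -a, 1:] x = 0} \<le> 2"
    by (rule card_roots_monic) auto
  then show ?thesis by (simp add: algebra_simps power2_eq_square)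
qed

text \<open>The roots of \<open>X\<^sup>2 - a X + c\<close> lie either in \<open>K\<close> or form a conjugate pair; rather than
  exhibiting them, we bound the sum by 2 for each \<open>a\<close> and compare the totals over all \<open>a\<close>.\<close>

lemma card_norm_trace_plus_card_roots:
  assumes c: "c \<in> K'" and a: "a \<in> K"
  shows "card {u. nrm u = c \<and> tr u = a} + card {e \<in> K. e ^ 2 - a * e + c = 0} = 2"
proof -
  let ?S = "\<lambda>a. {u. nrm u = c \<and> tr u = a}" and ?R = "\<lambda>a. {e \<in> K. e ^ 2 - a * e + c = 0}"
  have le: "card (?S a) + card (?R a) \<le> 2" for a
  proof -
    have root: "u ^ 2 - a * u + c = 0" if "u \<in> ?S a" for u
      using that by (auto simp: nrm_def tr_def power2_eq_square algebra_simps)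
    show ?thesis
    proof (cases "?S a \<inter> ?R a = {}")
      case True
      then have "card (?S a) + card (?R a) = card (?S a \<union> ?R a)"
        by (simp add: card_Un_disjoint)
      also have "\<dots> \<le> card {x. x ^ 2 - a * x + c = 0}"
        using root by (intro card_mono) auto
      finally show ?thesis using card_quadratic_roots_le[of a c] by linarith
    next
      case False
      then obtain u where u: "u \<in> K" "nrm u = c" "tr u = a" by auto
      \<comment> \<open>A common element is its own conjugate and therefore a double root, so each
        of the two sets has at most one element.\<close>
      then have "c = u * u" "a = u + u" by (auto simp: nrm_def tr_def)
      then have "x ^ 2 - a * x + c = (x - u) ^ 2" for x
        by (simp add: power2_eq_square algebra_simps)
      then have "x = u" if "x ^ 2 - a * x + c = 0" for x using that by simp
      then have "?S a \<subseteq> {u}" "?R a \<subseteq> {u}" using root by auto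
      then have "card (?S a) \<le> 1" "card (?R a) \<le> 1"
        using card_mono[of "{u}"] by fastforce+
      then show ?thesis by simp
    qed
  qed
  have "card {u. nrm u = c} = (\<Sum>a\<in>K. card {u \<in> {u. nrm u = c}. tr u = a})"
    by (rule card_fibres) auto
  then have S: "(\<Sum>a\<in>K. card (?S a)) = q + 1"
    using card_nrm_fibre[OF c] by simp
  \<comment> \<open>Each \<open>e\<close> in \<open>K'\<close> is a root for exactly one
    \<open>a\<close>, namely \<open>e + c / e\<close>. The root total is thus \<open>q - 1\<close>,
    complementing the norm-trace total \<open>q + 1\<close> to twice \<open>card K\<close>.\<close>
  have "card K' = (\<Sum>a\<in>K. card {e \<in> K'. e + c / e = a})"
    by (rule card_fibres) (use c in auto)
  also have "\<dots> = (\<Sum>a\<in>K. card (?R a))"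
  proof (intro sum.cong refl arg_cong[where f = card] Collect_cong)
    fix a e
    show "e \<in> K' \<and> e + c / e = a \<longleftrightarrow> e \<in> K \<and> e ^ 2 - a * e + c = 0"
      using c by (cases "e = 0") (auto simp: field_simps power2_eq_square)
  qed
  finally have R: "(\<Sum>a\<in>K. card (?R a)) = q - 1" using card_K_nonzero by simp
  have "(\<Sum>a\<in>K. card (?S a) + card (?R a)) = 2 * card K"
    using S R q_pos by (simp add: sum.distrib card_K)
  then show ?thesis
    using sum_upper_bound_eqD[of K "\<lambda>a. card (?S a) + card (?R a)" 2 a] le a by simp
qed

end

subsection \<open>The norm torus and lines\<close>

lemma sum_of_bool_card: "finite A \<Longrightarrow> (\<Sum>x\<in>A. of_bool (P x)) = int (card {x\<in>A. P x})"
  by (simp add: sum.If_cases of_bool_def Int_def flip: sum.inter_filter)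

context quadratic_extension
begin

text \<open>A binary relation, so that \<open>\<dots>\<close> in calculations denotes the right-hand side rather than
  the modulus.\<close>

definition cong_q :: "int \<Rightarrow> int \<Rightarrow> bool" (infix "\<simeq>" 50)
  where "a \<simeq> b \<longleftrightarrow> [a = b] (mod int q)"

lemma cong_q_dvd_iff: "a \<simeq> b \<longleftrightarrow> int q dvd a - b"
  by (simp add: cong_q_def cong_iff_dvd_diff)

lemma cong_q_refl [simp]: "a \<simeq> a"
  by (simp add: cong_q_def)

lemma cong_q_sym: "a \<simeq> b \<Longrightarrow> b \<simeq> a"
  by (simp add: cong_q_def cong_sym)

lemma cong_q_trans [trans]: "a \<simeq> b \<Longrightarrow> b \<simeq> c \<Longrightarrow> a \<simeq> c"
  unfolding cong_q_def by (rule cong_trans)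

lemma cong_q_eq_trans [trans]: "a \<simeq> b \<Longrightarrow> b = c \<Longrightarrow> a \<simeq> c"
  and eq_cong_q_trans [trans]: "a = b \<Longrightarrow> b \<simeq> c \<Longrightarrow> a \<simeq> c"
  by simp_all

lemma cong_q_add: "a \<simeq> b \<Longrightarrow> c \<simeq> d \<Longrightarrow> a + c \<simeq> b + d"
  unfolding cong_q_def by (rule cong_add)

lemma cong_q_diff: "a \<simeq> b \<Longrightarrow> c \<simeq> d \<Longrightarrow> a - c \<simeq> b - d"
  unfolding cong_q_def by (rule cong_diff)

lemma cong_q_mult: "a \<simeq> b \<Longrightarrow> c \<simeq> d \<Longrightarrow> a * c \<simeq> b * d"
  unfolding cong_q_def by (rule cong_mult)

lemma cong_q_minus: "a \<simeq> b \<Longrightarrow> - a \<simeq> - b"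
  using cong_q_diff[of 0 0 a b] by simp

lemma cong_q_sum: "(\<And>x. x \<in> A \<Longrightarrow> f x \<simeq> g x) \<Longrightarrow> sum f A \<simeq> sum g A"
  unfolding cong_q_def by (rule cong_sum)

declare sum_of_bool_eq [simp del] card_K [simp]

lemma int_q_minus_1 [simp]: "int (q - Suc 0) = int q - 1"
  using q_pos by (simp add: of_nat_diff)

lemma card_nrm_fibre' [simp]: "c \<in> K \<Longrightarrow> c \<noteq> 0 \<Longrightarrow> card {x. nrm x = c} = Suc q"
  using card_nrm_fibre[of c] by simp

lemma card_K'_cong: "int (card K') \<simeq> -1"
  by (simp add: cong_q_dvd_iff)

lemma q_plus_1_cong: "int q + 1 \<simeq> 1"
  by (simp add: cong_q_dvd_iff)

section \<open>Nonvanishing of linear forms on the torus, modulo \<open>q\<close>\<close>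

lemma sum_K'_scale:
  assumes "c \<in> K'"
  shows "(\<Sum>d\<in>K'. f (c * d)) = (\<Sum>d\<in>K'. f d)"
  by (rule sum.reindex_bij_witness[of _ "\<lambda>d. d / c" "\<lambda>d. c * d"]) (use assms in auto)

lemma sum_K'_inverse: "(\<Sum>d\<in>K'. f (1 / d)) = (\<Sum>d\<in>K'. f d)"
  by (rule sum.reindex_bij_witness[of _ "\<lambda>d. 1 / d" "\<lambda>d. 1 / d"]) auto

text \<open>For \<open>a \<noteq> 0\<close> the only zero is \<open>- s / a\<close>, which lies in
  \<open>K'\<close> exactly when \<open>s \<noteq> 0\<close>; the size of \<open>K'\<close> is
  \<open>-1\<close> modulo \<open>q\<close>.\<close>

lemma sum_K'_affine_nonzero:
  assumes "a \<in> K" "s \<in> K"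
  shows "(\<Sum>d\<in>K'. of_bool (d * a + s \<noteq> 0)) \<simeq> - of_bool (a \<noteq> 0) - of_bool (s \<noteq> 0)"
proof (cases "a = 0")
  case True
  then have "(\<Sum>d\<in>K'. of_bool (d * a + s \<noteq> 0)) = int (card K') * of_bool (s \<noteq> 0)"
    by simp
  then show ?thesis using True assms by (simp add: cong_q_dvd_iff)
next
  case False
  have "(\<Sum>d\<in>K'. of_bool (d * a + s \<noteq> 0)) = (\<Sum>d\<in>K'. 1 - of_bool (d = - s / a) :: int)"
    using False by (intro sum.cong) (auto simp: field_simps eq_neg_iff_add_eq_0)
  also have "\<dots> = int (card K') - of_bool (- s / a \<in> K')"
    by (subst sum_subtractf) (auto simp: of_bool_def)
  also have "- s / a \<in> K' \<longleftrightarrow> s \<noteq> 0"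
    using False assms by auto
  finally show ?thesis using False by (simp add: cong_q_dvd_iff)
qed

lemma sum_K'_linear2_nonzero:
  assumes "a \<in> K" "b \<in> K"
  shows "(\<Sum>d\<in>K'. \<Sum>e\<in>K'. of_bool (d * a + e * b \<noteq> 0)) \<simeq> of_bool (a \<noteq> 0) + of_bool (b \<noteq> 0)"
proof -
  have "(\<Sum>d\<in>K'. \<Sum>e\<in>K'. of_bool (d * a + e * b \<noteq> 0)) = (\<Sum>e\<in>K'. \<Sum>d\<in>K'. of_bool (d * a + e * b \<noteq> 0))"
    by (rule sum.swap)
  also have "\<dots> \<simeq> (\<Sum>e\<in>K'. - of_bool (a \<noteq> 0) - of_bool (e * b \<noteq> 0))"
    using assms by (intro cong_q_sum sum_K'_affine_nonzero) auto
  also have "(\<Sum>e\<in>K'. - of_bool (a \<noteq> 0) - of_bool (e * b \<noteq> 0)) =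
      int (card K') * (- of_bool (a \<noteq> 0) - of_bool (b \<noteq> 0))"
    by (simp cong: sum.cong_simp)
  also have "\<dots> \<simeq> (-1) * (- of_bool (a \<noteq> 0) - of_bool (b \<noteq> 0))"
    by (intro cong_q_mult cong_q_refl card_K'_cong)
  finally show ?thesis by (simp add: add.commute)
qed

lemma sum_K'_linear3_nonzero:
  assumes "a \<in> K" "b \<in> K" "c \<in> K"
  shows "(\<Sum>d\<in>K'. \<Sum>e\<in>K'. \<Sum>f\<in>K'. of_bool (d * a + e * b + f * c \<noteq> 0)) \<simeq>
    - of_bool (a \<noteq> 0) - of_bool (b \<noteq> 0) - of_bool (c \<noteq> 0)"
proof -
  have "(\<Sum>d\<in>K'. \<Sum>e\<in>K'. \<Sum>f\<in>K'. of_bool (d * a + e * b + f * c \<noteq> 0)) =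
     (\<Sum>d\<in>K'. \<Sum>e\<in>K'. \<Sum>f\<in>K'. of_bool (f * c + (d * a + e * b) \<noteq> 0))"
    by (simp add: ac_simps)
  also have "\<dots> \<simeq> (\<Sum>d\<in>K'. \<Sum>e\<in>K'. - of_bool (c \<noteq> 0) - of_bool (d * a + e * b \<noteq> 0))"
    using assms by (intro cong_q_sum sum_K'_affine_nonzero) auto
  also have "\<dots> = - (int (card K') * int (card K') * of_bool (c \<noteq> 0)) -
      (\<Sum>d\<in>K'. \<Sum>e\<in>K'. of_bool (d * a + e * b \<noteq> 0))"
    by (simp add: sum_subtractf)
  also have "\<dots> \<simeq> - ((-1) * (-1) * of_bool (c \<noteq> 0)) - (of_bool (a \<noteq> 0) + of_bool (b \<noteq> 0))"
    using assms by (intro cong_q_diff cong_q_minus cong_q_mult cong_q_refl card_K'_cong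
        sum_K'_linear2_nonzero)
  also have "- ((-1) * (-1) * of_bool (c \<noteq> 0)) - (of_bool (a \<noteq> 0) + of_bool (b \<noteq> 0) :: int) =
      - of_bool (a \<noteq> 0) - of_bool (b \<noteq> 0) - of_bool (c \<noteq> 0)"
    by simp
  finally show ?thesis .
qed

text \<open>Contribution of a pair of points to the convolution \<open>h * h\<close>:
  \<open>A\<close> holds the coordinate norms of one point, \<open>B\<close> those of the other
  multiplied by the torus element at which the convolution is evaluated.\<close>

definition torus_sum :: "'a \<Rightarrow> 'a \<Rightarrow> 'a \<Rightarrow> 'a \<Rightarrow> 'a \<Rightarrow> 'a \<Rightarrow> int" where
  "torus_sum A1 A2 A3 B1 B2 B3 = (\<Sum>d1\<in>K'. \<Sum>d2\<in>K'. \<Sum>d3\<in>K'.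
     of_bool (d1 * A1 + d2 * A2 + d3 * A3 \<noteq> 0 \<and> B1 / d1 + B2 / d2 + B3 / d3 \<noteq> 0))"

text \<open>Among the vectors \<open>w\<close> with prescribed coordinate norms, those whose line
  misses the point \<open>(x1, x2, x3)\<close> are counted.\<close>

definition line_sum :: "'a \<Rightarrow> 'a \<Rightarrow> 'a \<Rightarrow> 'a \<Rightarrow> 'a \<Rightarrow> 'a \<Rightarrow> int" where
  "line_sum x1 x2 x3 B1 B2 B3 = (\<Sum>w1 | nrm w1 = B1. \<Sum>w2 | nrm w2 = B2. \<Sum>w3 | nrm w3 = B3.
     of_bool (w1 * x1 + w2 * x2 + w3 * x3 \<noteq> 0))"

lemma torus_sum_swap12: "torus_sum A2 A1 A3 B2 B1 B3 = torus_sum A1 A2 A3 B1 B2 B3"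
  unfolding torus_sum_def by (subst sum.swap) (simp add: ac_simps)

lemma torus_sum_swap23: "torus_sum A1 A3 A2 B1 B3 B2 = torus_sum A1 A2 A3 B1 B2 B3"
  unfolding torus_sum_def by (rule sum.cong[OF refl], subst sum.swap) (simp add: ac_simps)

lemma line_sum_swap12: "line_sum x2 x1 x3 B2 B1 B3 = line_sum x1 x2 x3 B1 B2 B3"
  unfolding line_sum_def by (subst sum.swap) (simp add: ac_simps)

lemma line_sum_swap23: "line_sum x1 x3 x2 B1 B3 B2 = line_sum x1 x2 x3 B1 B2 B3"
  unfolding line_sum_def by (rule sum.cong[OF refl], subst sum.swap) (simp add: ac_simps)

lemma nrm_fibre_0 [simp]: "{x. nrm x = 0} = {0}"
  by auto

text \<open>For \<open>x \<noteq> 0\<close> the only zero is \<open>- s / x\<close>, which has norm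
  \<open>c\<close> exactly when \<open>nrm s = c * nrm x\<close>; the fibre has \<open>q + 1\<close>
  elements, which is 1 modulo \<open>q\<close>.\<close>

lemma sum_nrm_fibre_affine_nonzero:
  assumes "c \<in> K'"
  shows "(\<Sum>w | nrm w = c. of_bool (w * x + s \<noteq> 0)) \<simeq> of_bool (nrm s \<noteq> c * nrm x)"
proof (cases "x = 0")
  case True
  then have "(\<Sum>w | nrm w = c. of_bool (w * x + s \<noteq> 0)) = (int q + 1) * of_bool (s \<noteq> 0)"
    using assms by (simp add: algebra_simps)
  then show ?thesis using True assms by (simp add: cong_q_dvd_iff)
next
  case False
  have "(\<Sum>w | nrm w = c. of_bool (w * x + s \<noteq> 0)) = (\<Sum>w | nrm w = c. 1 - of_bool (w = - s / x) :: int)"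
    using False by (intro sum.cong) (auto simp: field_simps eq_neg_iff_add_eq_0)
  also have "\<dots> = int q + 1 - of_bool (nrm (- s / x) = c)"
    using assms by (subst sum_subtractf) (auto simp: of_bool_def)
  also have "nrm (- s / x) = c \<longleftrightarrow> nrm s = c * nrm x"
    using False by (simp add: nrm_divide field_simps)
  finally show ?thesis using False by (simp add: cong_q_dvd_iff)
qed

lemma sum_nrm_fibre_scale:
  assumes "nrm w \<noteq> 0"
  shows "(\<Sum>v | nrm v = c. f v) = (\<Sum>v | nrm v = c / nrm w. f (v * w))"
  by (rule sum.reindex_bij_witness[of _ "\<lambda>v. v * w" "\<lambda>v. v / w"])
     (use assms in \<open>auto simp: nrm_mult nrm_divide\<close>)

section \<open>Pointwise identities between torus sums and line sums\<close>

lemma torus_sum_B1: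
  assumes "A1 \<in> K" "A2 \<in> K" "A3 \<in> K" "B1 \<noteq> 0"
  shows "torus_sum A1 A2 A3 B1 0 0 \<simeq> - of_bool (A1 \<noteq> 0) - of_bool (A2 \<noteq> 0) - of_bool (A3 \<noteq> 0)"
proof -
  have "torus_sum A1 A2 A3 B1 0 0 =
      (\<Sum>d\<in>K'. \<Sum>e\<in>K'. \<Sum>f\<in>K'. of_bool (d * A1 + e * A2 + f * A3 \<noteq> 0))"
    unfolding torus_sum_def using assms(4) by (intro sum.cong refl) auto
  then show ?thesis using sum_K'_linear3_nonzero assms by simp
qed

text \<open>The condition on reciprocals excludes exactly the triples with \<open>e = c * d\<close>,
  so the unrestricted three-variable count is corrected by a two-variable count.\<close>

lemma torus_sum_B12:
  assumes "A1 \<in> K" "A2 \<in> K" "A3 \<in> K" "B1 \<in> K'" "B2 \<in> K'"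
  shows "torus_sum A1 A2 A3 B1 B2 0 \<simeq> - of_bool (A1 \<noteq> 0) - of_bool (A2 \<noteq> 0) - 2 * of_bool (A3 \<noteq> 0)
    - of_bool (B1 * A1 \<noteq> B2 * A2)"
proof -
  define c where "c = - B2 / B1"
  have c: "c \<in> K'" using assms by (auto simp: c_def)
  have eq: "B1 / d + B2 / e = 0 \<longleftrightarrow> e = c * d" if "d \<in> K'" "e \<in> K'" for d e
    using that assms(4) by (auto simp: c_def divide_simps) (auto simp: algebra_simps eq_neg_iff_add_eq_0)
  have "torus_sum A1 A2 A3 B1 B2 0 =
      (\<Sum>d\<in>K'. \<Sum>e\<in>K'. \<Sum>f\<in>K'. of_bool (d * A1 + e * A2 + f * A3 \<noteq> 0) -
         (if e = c * d then of_bool (d * A1 + e * A2 + f * A3 \<noteq> 0) else 0))"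
    unfolding torus_sum_def using eq by (intro sum.cong refl) auto
  also have "\<dots> = (\<Sum>d\<in>K'. \<Sum>e\<in>K'. \<Sum>f\<in>K'. of_bool (d * A1 + e * A2 + f * A3 \<noteq> 0)) -
      (\<Sum>d\<in>K'. \<Sum>e\<in>K'. if e = c * d then (\<Sum>f\<in>K'. of_bool (d * A1 + e * A2 + f * A3 \<noteq> 0)) else 0)"
    by (simp only: sum_subtractf, intro arg_cong2[where f = minus] sum.cong refl) simp
  also have "(\<Sum>d\<in>K'. \<Sum>e\<in>K'. if e = c * d then (\<Sum>f\<in>K'. of_bool (d * A1 + e * A2 + f * A3 \<noteq> 0)) else 0) =
      (\<Sum>d\<in>K'. \<Sum>f\<in>K'. of_bool (d * (A1 + c * A2) + f * A3 \<noteq> 0) :: int)"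
    by (rule sum.cong[OF refl], subst sum.delta) (use c in \<open>auto simp: algebra_simps\<close>)
  also have "(\<Sum>d\<in>K'. \<Sum>e\<in>K'. \<Sum>f\<in>K'. of_bool (d * A1 + e * A2 + f * A3 \<noteq> 0)) -
      (\<Sum>d\<in>K'. \<Sum>f\<in>K'. of_bool (d * (A1 + c * A2) + f * A3 \<noteq> 0) :: int) \<simeq>
      (- of_bool (A1 \<noteq> 0) - of_bool (A2 \<noteq> 0) - of_bool (A3 \<noteq> 0)) -
      (of_bool (A1 + c * A2 \<noteq> 0) + of_bool (A3 \<noteq> 0))"
    using assms c by (intro cong_q_diff sum_K'_linear3_nonzero sum_K'_linear2_nonzero) auto
  also have "A1 + c * A2 \<noteq> 0 \<longleftrightarrow> B1 * A1 \<noteq> B2 * A2"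
    using assms(4) by (auto simp: c_def field_simps)
  finally show ?thesis by (simp add: algebra_simps)
qed

lemma line_sum_B12:
  assumes "B1 \<in> K'" "B2 \<in> K'"
  shows "line_sum x1 x2 x3 B1 B2 0 \<simeq> of_bool (B1 * nrm x1 \<noteq> B2 * nrm x2)"
proof -
  have "line_sum x1 x2 x3 B1 B2 0 = (\<Sum>w1 | nrm w1 = B1. \<Sum>w2 | nrm w2 = B2. of_bool (w2 * x2 + w1 * x1 \<noteq> 0))"
    by (simp add: line_sum_def add.commute)
  also have "\<dots> \<simeq> (\<Sum>w1 | nrm w1 = B1. of_bool (nrm (w1 * x1) \<noteq> B2 * nrm x2))"
    using assms by (intro cong_q_sum sum_nrm_fibre_affine_nonzero)
  also have "\<dots> = (\<Sum>w1 | nrm w1 = B1. of_bool (B1 * nrm x1 \<noteq> B2 * nrm x2))"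
    by (intro sum.cong refl) (simp add: nrm_mult)
  also have "\<dots> = (int q + 1) * of_bool (B1 * nrm x1 \<noteq> B2 * nrm x2)"
    using assms by (simp add: algebra_simps)
  also have "\<dots> \<simeq> 1 * of_bool (B1 * nrm x1 \<noteq> B2 * nrm x2)"
    by (intro cong_q_mult cong_q_refl q_plus_1_cong)
  finally show ?thesis by simp
qed

text \<open>The comparison of \<open>B1 * nrm x1\<close> with \<open>B2 * nrm x2\<close> enters the
  two sums with opposite signs. What remains depends only on which coordinates vanish, and this can
  be summed over the points of a unital.\<close>

lemma torus_line_sum_B12:
  assumes "B1 \<in> K'" "B2 \<in> K'"
  shows "torus_sum (nrm x1) (nrm x2) (nrm x3) B1 B2 0 + line_sum x1 x2 x3 B1 B2 0 \<simeq>
    - of_bool (x1 \<noteq> 0) - of_bool (x2 \<noteq> 0) - 2 * of_bool (x3 \<noteq> 0)"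
  using cong_q_add[OF torus_sum_B12[OF _ _ _ assms] line_sum_B12[OF assms, of x1 x2 x3], of "nrm x1" "nrm x2" "nrm x3"]
  by simp

text \<open>After scaling away one variable, \<open>line_sum\<close> and \<open>torus_sum\<close> count, respectively, the
  norm-trace type and the root type solutions of the same quadratic equation.\<close>

lemma card_sum_scaled:
  fixes x1 x2 x3 B1 B2 B3 :: 'a
  assumes "x3 \<noteq> 0" and B: "B1 \<in> K'" "B2 \<in> K'" "B3 \<in> K'"
  defines "a \<equiv> B3 * nrm x3 - B1 * nrm x1 - B2 * nrm x2"
  shows "int (card {v. nrm v = B1 / B2 \<and> B2 * tr (v * (x1 * cj x2)) = a}) +
      int (card {e \<in> K'. B2 * nrm x1 * e ^ 2 - a * e + B1 * nrm x2 = 0}) \<simeq>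
      of_bool (x1 \<noteq> 0) + of_bool (x2 \<noteq> 0)"
    (is "int (card ?S) + int (card ?R) \<simeq> _")
proof -
  have a: "a \<in> K" using B by (auto simp: a_def)
  consider (both) "x1 \<noteq> 0" "x2 \<noteq> 0" | (first) "x1 \<noteq> 0" "x2 = 0" | (second) "x1 = 0" "x2 \<noteq> 0"
    | (none) "x1 = 0" "x2 = 0" by auto
  then show ?thesis
  proof cases
    case both
    \<comment> \<open>Scaling by \<open>g\<close> turns the first set into elements of norm
      \<open>c\<close> and trace \<open>a\<close>; scaling by \<open>B2 * nrm x1\<close> makes the
      quadratic monic with the same \<open>c\<close> and \<open>a\<close>.\<close>
    define c where "c = B1 * B2 * nrm x1 * nrm x2"
    define g where "g = B2 * (x1 * cj x2)"
    have c: "c \<in> K'" using B both by (auto simp: c_def)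
    have g: "g \<noteq> 0" using B both by (auto simp: g_def)
    have nrm_g: "nrm g = B2 ^ 2 * nrm x1 * nrm x2"
      using B by (simp add: g_def nrm_mult) (simp add: nrm_def[of B2] power2_eq_square)
    have b1: "bij_betw (\<lambda>v. v * g) ?S {u. nrm u = c \<and> tr u = a}"
    proof (rule bij_betw_byWitness[where f' = "\<lambda>u. u / g"])
      have "nrm (v * g) = c \<longleftrightarrow> nrm v = B1 / B2" for v
        using B both by (auto simp: nrm_mult nrm_g c_def field_simps power2_eq_square)
      moreover have "tr (v * g) = B2 * tr (v * (x1 * cj x2))" for v
        using tr_scale[of B2 "v * (x1 * cj x2)"] B by (simp add: g_def ac_simps)
      ultimately show "(\<lambda>v. v * g) ` ?S \<subseteq> {u. nrm u = c \<and> tr u = a}"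
        and "(\<lambda>u. u / g) ` {u. nrm u = c \<and> tr u = a} \<subseteq> ?S"
        using g by (auto, metis nonzero_divide_mult_cancel_right times_divide_eq_left nonzero_eq_divide_eq)+
    qed (use g in auto)
    have b2: "bij_betw (\<lambda>e. B2 * nrm x1 * e) ?R {e \<in> K. e ^ 2 - a * e + c = 0}"
    proof (rule bij_betw_byWitness[where f' = "\<lambda>e. e / (B2 * nrm x1)"])
      have "(B2 * nrm x1 * e) ^ 2 - a * (B2 * nrm x1 * e) + c =
          B2 * nrm x1 * (B2 * nrm x1 * e ^ 2 - a * e + B1 * nrm x2)" for e
        by (simp add: c_def power2_eq_square algebra_simps)
      then have *: "(B2 * nrm x1 * e) ^ 2 - a * (B2 * nrm x1 * e) + c = 0 \<longleftrightarrow>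
          B2 * nrm x1 * e ^ 2 - a * e + B1 * nrm x2 = 0" for e
        using B both by simp
      then show "(\<lambda>e. B2 * nrm x1 * e) ` ?R \<subseteq> {e \<in> K. e ^ 2 - a * e + c = 0}"
        using B by auto
      show "(\<lambda>e. e / (B2 * nrm x1)) ` {e \<in> K. e ^ 2 - a * e + c = 0} \<subseteq> ?R"
      proof safe
        fix e assume e: "e \<in> K" "e ^ 2 - a * e + c = 0"
        show "e / (B2 * nrm x1) \<in> K" using e B by auto
        show "B2 * nrm x1 * (e / (B2 * nrm x1)) ^ 2 - a * (e / (B2 * nrm x1)) + B1 * nrm x2 = 0"
          using *[of "e / (B2 * nrm x1)"] e B both by simp
        show False if "e / (B2 * nrm x1) = 0" using that e c B both by auto
      qed
    qed (use B both in auto)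
    have "card ?S + card ?R = 2"
      unfolding bij_betw_same_card[OF b1] bij_betw_same_card[OF b2]
      by (rule card_norm_trace_plus_card_roots[OF c a])
    then have "int (card ?S) + int (card ?R) = 2" by linarith
    then show ?thesis using both by simp
  next
    case first
    \<comment> \<open>The trace condition degenerates to \<open>a = 0\<close>, so the first set is a
      full norm fibre, of size 1 modulo \<open>q\<close>, or empty; the quadratic loses its constant
      term and has one nonzero root in exactly the other case.\<close>
    have "?S = (if a = 0 then {v. nrm v = B1 / B2} else {})"
      using first by (auto simp: tr_def)
    then have "int (card ?S) = (int q + 1) * of_bool (a = 0)"
      using B by simp
    moreover have "?R = (if a = 0 then {} else {a / (B2 * nrm x1)})"
    proof -
      have "B2 * nrm x1 * e ^ 2 - a * e = e * (B2 * nrm x1 * e - a)" for e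
        by (simp add: power2_eq_square algebra_simps)
      then have "B2 * nrm x1 * e ^ 2 - a * e = 0 \<longleftrightarrow> e = 0 \<or> e = a / (B2 * nrm x1)" for e
        using B first by (auto simp: field_simps)
      moreover have "B2 * nrm x1 * e ^ 2 - a * e + B1 * nrm x2 = B2 * nrm x1 * e ^ 2 - a * e" for e
        using first by simp
      ultimately have R: "?R = {e \<in> K'. e = a / (B2 * nrm x1)}"
        by (simp only:) blast
      have "{e \<in> K'. e = r} = (if r = 0 then {} else {r})" if "r \<in> K" for r
        using that by auto
      moreover have "a / (B2 * nrm x1) \<in> K" "a / (B2 * nrm x1) = 0 \<longleftrightarrow> a = 0"
        using a B first by simp_all
      ultimately show ?thesis unfolding R by (simp only:)
    qed
    then have "int (card ?R) = of_bool (a \<noteq> 0)" by simp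
    ultimately show ?thesis using first by (simp add: cong_q_dvd_iff)
  next
    case second
    have "?S = (if a = 0 then {v. nrm v = B1 / B2} else {})"
      using second by (auto simp: tr_def)
    then have "int (card ?S) = (int q + 1) * of_bool (a = 0)"
      using B by simp
    moreover have "?R = (if a = 0 then {} else {B1 * nrm x2 / a})"
      using second B a by (auto simp: field_simps)
    then have "int (card ?R) = of_bool (a \<noteq> 0)" by simp
    ultimately show ?thesis using second by (simp add: cong_q_dvd_iff)
  next
    case none
    then have "a \<noteq> 0" using assms(1) B by (simp add: a_def)
    then have "?S = {}" "?R = {}" using none by (auto simp: tr_def)
    then show ?thesis using none by (simp only: card.empty) simp
  qed
qed

text \<open>Summing over \<open>w3\<close> leaves a condition on
  \<open>nrm (w1 * x1 + w2 * x2)\<close>. With \<open>w1 = v * w2\<close> the factor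
  \<open>nrm w2 = B2\<close> splits off, so the condition no longer depends on \<open>w2\<close>,
  whose \<open>q + 1\<close> values count as 1.\<close>

lemma line_sum_scaled:
  fixes x1 x2 x3 B1 B2 B3 :: 'a
  assumes B: "B1 \<in> K'" "B2 \<in> K'" "B3 \<in> K'"
  defines "a \<equiv> B3 * nrm x3 - B1 * nrm x1 - B2 * nrm x2"
  shows "line_sum x1 x2 x3 B1 B2 B3 \<simeq> 1 - int (card {v. nrm v = B1 / B2 \<and> B2 * tr (v * (x1 * cj x2)) = a})"
    (is "_ \<simeq> 1 - int (card ?S)")
proof -
  have "line_sum x1 x2 x3 B1 B2 B3 =
      (\<Sum>w1 | nrm w1 = B1. \<Sum>w2 | nrm w2 = B2. \<Sum>w3 | nrm w3 = B3. of_bool (w3 * x3 + (w1 * x1 + w2 * x2) \<noteq> 0))"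
    by (simp add: line_sum_def ac_simps)
  also have "\<dots> \<simeq> (\<Sum>w1 | nrm w1 = B1. \<Sum>w2 | nrm w2 = B2. of_bool (nrm (w1 * x1 + w2 * x2) \<noteq> B3 * nrm x3))"
    using B by (intro cong_q_sum sum_nrm_fibre_affine_nonzero)
  also have "\<dots> = (\<Sum>w2 | nrm w2 = B2. \<Sum>w1 | nrm w1 = B1. of_bool (nrm (w1 * x1 + w2 * x2) \<noteq> B3 * nrm x3))"
    by (rule sum.swap)
  also have "\<dots> = (\<Sum>w2 | nrm w2 = B2. \<Sum>v | nrm v = B1 / B2. of_bool (B2 * tr (v * (x1 * cj x2)) \<noteq> a))"
  proof (rule sum.cong[OF refl])
    fix w2 assume w2: "w2 \<in> {w2. nrm w2 = B2}"
    then have "(\<Sum>w1 | nrm w1 = B1. of_bool (nrm (w1 * x1 + w2 * x2) \<noteq> B3 * nrm x3)) =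
        (\<Sum>v | nrm v = B1 / B2. of_bool (nrm (v * w2 * x1 + w2 * x2) \<noteq> B3 * nrm x3) :: int)"
      using B sum_nrm_fibre_scale[of w2 "\<lambda>w1. of_bool (nrm (w1 * x1 + w2 * x2) \<noteq> B3 * nrm x3)" B1]
      by simp
    also have "\<dots> = (\<Sum>v | nrm v = B1 / B2. of_bool (B2 * tr (v * (x1 * cj x2)) \<noteq> a))"
    proof (intro sum.cong refl arg_cong[where f = of_bool])
      fix v assume v: "v \<in> {v. nrm v = B1 / B2}"
      have "nrm (v * w2 * x1 + w2 * x2) = nrm w2 * nrm (v * x1 + x2)"
        by (simp add: algebra_simps flip: nrm_mult)
      also have "\<dots> = B1 * nrm x1 + B2 * nrm x2 + B2 * tr (v * (x1 * cj x2))"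
        unfolding nrm_add nrm_mult mult.assoc[of v] using v w2 B by (simp add: distrib_left)
      finally show "nrm (v * w2 * x1 + w2 * x2) \<noteq> B3 * nrm x3 \<longleftrightarrow> B2 * tr (v * (x1 * cj x2)) \<noteq> a"
        by (auto simp: a_def algebra_simps)
    qed
    finally show "(\<Sum>w1 | nrm w1 = B1. of_bool (nrm (w1 * x1 + w2 * x2) \<noteq> B3 * nrm x3) :: int) =
      (\<Sum>v | nrm v = B1 / B2. of_bool (B2 * tr (v * (x1 * cj x2)) \<noteq> a))" .
  qed
  also have "\<dots> = (int q + 1) * (\<Sum>v | nrm v = B1 / B2. 1 - of_bool (B2 * tr (v * (x1 * cj x2)) = a))"
    using B by (simp add: algebra_simps of_bool_not_iff)
  also have "(\<Sum>v | nrm v = B1 / B2. 1 - of_bool (B2 * tr (v * (x1 * cj x2)) = a)) = int q + 1 - int (card ?S)"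
    using B by (simp add: sum_subtractf sum_of_bool_card)
  also have "(int q + 1) * (int q + 1 - int (card ?S)) \<simeq> 1 * (1 - int (card ?S))"
    by (intro cong_q_mult cong_q_diff q_plus_1_cong cong_q_refl)
  finally show ?thesis by simp
qed

text \<open>Inclusion-exclusion reduces to the common zeros of the two forms. Both are homogeneous,
  so replacing \<open>d\<close> by \<open>e * d\<close> removes \<open>e\<close>; the first equation
  determines \<open>f\<close>, and the second becomes the quadratic in \<open>d\<close>.\<close>

lemma torus_sum_scaled:
  fixes A1 A2 A3 B1 B2 B3 :: 'a
  assumes A: "A1 \<in> K" "A2 \<in> K" "A3 \<in> K'" and B: "B1 \<in> K'" "B2 \<in> K'" "B3 \<in> K'"
  defines "a \<equiv> B3 * A3 - B1 * A1 - B2 * A2"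
  shows "torus_sum A1 A2 A3 B1 B2 B3 \<simeq> - of_bool (A1 \<noteq> 0) - of_bool (A2 \<noteq> 0) - 3
    - int (card {e \<in> K'. B2 * A1 * e ^ 2 - a * e + B1 * A2 = 0})"
    (is "_ \<simeq> _ - int (card ?R)")
proof -
  let ?P = "\<lambda>d e f. d * A1 + e * A2 + f * A3 = 0" and ?Q = "\<lambda>d e f. B1 / d + B2 / e + B3 / f = 0"
  have "torus_sum A1 A2 A3 B1 B2 B3 = (\<Sum>d\<in>K'. \<Sum>e\<in>K'. \<Sum>f\<in>K'.
      of_bool (\<not> ?P d e f) + of_bool (\<not> ?Q d e f) - 1 + of_bool (?P d e f \<and> ?Q d e f))"
    unfolding torus_sum_def by (intro sum.cong refl) (auto simp: of_bool_def)
  also have "\<dots> = (\<Sum>d\<in>K'. \<Sum>e\<in>K'. \<Sum>f\<in>K'. of_bool (\<not> ?P d e f)) +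
      (\<Sum>d\<in>K'. \<Sum>e\<in>K'. \<Sum>f\<in>K'. of_bool (\<not> ?Q d e f)) - int (card K') * (int (card K') * int (card K')) +
      (\<Sum>d\<in>K'. \<Sum>e\<in>K'. \<Sum>f\<in>K'. of_bool (?P d e f \<and> ?Q d e f))"
    by (simp only: sum.distrib sum_subtractf sum_constant)
  also have "(\<Sum>d\<in>K'. \<Sum>e\<in>K'. \<Sum>f\<in>K'. of_bool (\<not> ?Q d e f) :: int) =
      (\<Sum>d\<in>K'. \<Sum>e\<in>K'. \<Sum>f\<in>K'. of_bool (d * B1 + e * B2 + f * B3 \<noteq> 0))"
  proof -
    have "(\<Sum>d\<in>K'. \<Sum>e\<in>K'. \<Sum>f\<in>K'. of_bool (\<not> ?Q d e f) :: int) =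
      (\<Sum>d\<in>K'. \<Sum>e\<in>K'. \<Sum>f\<in>K'. of_bool ((1 / d) * B1 + (1 / e) * B2 + (1 / f) * B3 \<noteq> 0))"
      by simp
    also have "\<dots> = (\<Sum>d\<in>K'. \<Sum>e\<in>K'. \<Sum>f\<in>K'. of_bool ((1 / d) * B1 + (1 / e) * B2 + f * B3 \<noteq> 0))"
      by (intro sum.cong[OF refl] sum_K'_inverse)
    also have "\<dots> = (\<Sum>d\<in>K'. \<Sum>e\<in>K'. \<Sum>f\<in>K'. of_bool ((1 / d) * B1 + e * B2 + f * B3 \<noteq> 0))"
      by (rule sum.cong[OF refl], rule sum_K'_inverse)
    also have "\<dots> = (\<Sum>d\<in>K'. \<Sum>e\<in>K'. \<Sum>f\<in>K'. of_bool (d * B1 + e * B2 + f * B3 \<noteq> 0))"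
      by (rule sum_K'_inverse)
    finally show ?thesis .
  qed
  also have "(\<Sum>d\<in>K'. \<Sum>e\<in>K'. \<Sum>f\<in>K'. of_bool (?P d e f \<and> ?Q d e f)) = int (card K') * int (card ?R)"
  proof -
    have inner: "(\<Sum>f\<in>K'. of_bool (?P (e * d) e f \<and> ?Q (e * d) e f)) =
        (of_bool (B2 * A1 * d ^ 2 - a * d + B1 * A2 = 0) :: int)" if d: "d \<in> K'" and e: "e \<in> K'" for d e
    proof -
      define f0 where "f0 = - (e * (d * A1 + A2)) / A3"
      have f: "?P (e * d) e f \<longleftrightarrow> f = f0" for f
        using A by (auto simp: f0_def field_simps eq_neg_iff_add_eq_0)
      have "(\<Sum>f\<in>K'. of_bool (?P (e * d) e f \<and> ?Q (e * d) e f)) =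
          (\<Sum>f\<in>K'. if f = f0 then of_bool (?Q (e * d) e f) else (0::int))"
        unfolding f by (intro sum.cong) auto
      also have "\<dots> = of_bool (f0 \<in> K' \<and> ?Q (e * d) e f0)"
        by (subst sum.delta) auto
      also have "f0 \<in> K' \<longleftrightarrow> d * A1 + A2 \<noteq> 0"
        using A d e by (auto simp: f0_def)
      also have "d * A1 + A2 \<noteq> 0 \<and> ?Q (e * d) e f0 \<longleftrightarrow> B2 * A1 * d ^ 2 - a * d + B1 * A2 = 0"
      proof (cases "d * A1 + A2 = 0")
        case True
        \<comment> \<open>Here \<open>f0 = 0\<close> is excluded, and the quadratic has no zero
          either: its value is \<open>- B3 * A3 * d\<close>.\<close>
        have "B2 * A1 * d ^ 2 - a * d + B1 * A2 = (B1 + B2 * d) * (d * A1 + A2) - B3 * A3 * d"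
          by (simp add: a_def power2_eq_square algebra_simps)
        then show ?thesis using True A B d by simp
      next
        case False
        have "?Q (e * d) e f0 \<longleftrightarrow> B1 / d + B2 - B3 * A3 / (d * A1 + A2) = 0"
        proof -
          have "B1 / (e * d) + B2 / e + B3 / f0 = (B1 / d + B2 - B3 * A3 / (d * A1 + A2)) / e"
            using d e A False by (simp add: f0_def diff_divide_distrib add_divide_distrib mult.commute)
          then show ?thesis using e by simp
        qed
        also have "\<dots> \<longleftrightarrow> B2 * A1 * d ^ 2 - a * d + B1 * A2 = 0"
          using d False by (simp add: divide_simps) (auto simp: a_def power2_eq_square algebra_simps)
        finally show ?thesis using False by simp
      qed
      finally show ?thesis .
    qed
    have "(\<Sum>d\<in>K'. \<Sum>e\<in>K'. \<Sum>f\<in>K'. of_bool (?P d e f \<and> ?Q d e f) :: int) =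
        (\<Sum>e\<in>K'. \<Sum>d\<in>K'. \<Sum>f\<in>K'. of_bool (?P d e f \<and> ?Q d e f))"
      by (rule sum.swap)
    also have "\<dots> = (\<Sum>e\<in>K'. \<Sum>d\<in>K'. \<Sum>f\<in>K'. of_bool (?P (e * d) e f \<and> ?Q (e * d) e f))"
      by (intro sum.cong[OF refl] sum_K'_scale[symmetric])
    also have "\<dots> = (\<Sum>e\<in>K'. \<Sum>d\<in>K'. of_bool (B2 * A1 * d ^ 2 - a * d + B1 * A2 = 0))"
      by (intro sum.cong[OF refl] inner)
    also have "\<dots> = int (card K') * int (card ?R)"
      by (simp only: sum_constant sum_of_bool_card[OF finite_F])
    finally show ?thesis .
  qed
  also have "(\<Sum>d\<in>K'. \<Sum>e\<in>K'. \<Sum>f\<in>K'. of_bool (\<not> ?P d e f)) +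
      (\<Sum>d\<in>K'. \<Sum>e\<in>K'. \<Sum>f\<in>K'. of_bool (d * B1 + e * B2 + f * B3 \<noteq> 0)) -
      int (card K') * (int (card K') * int (card K')) + int (card K') * int (card ?R) \<simeq>
      (- of_bool (A1 \<noteq> 0) - of_bool (A2 \<noteq> 0) - of_bool (A3 \<noteq> 0)) +
      (- of_bool (B1 \<noteq> 0) - of_bool (B2 \<noteq> 0) - of_bool (B3 \<noteq> 0)) - (-1) * ((-1) * (-1)) +
      (-1) * int (card ?R)"
    using A B by (intro cong_q_add cong_q_diff cong_q_mult sum_K'_linear3_nonzero card_K'_cong cong_q_refl) auto
  also have "\<dots> = - of_bool (A1 \<noteq> 0) - of_bool (A2 \<noteq> 0) - 3 - int (card ?R)"
    using A B by simp
  finally show ?thesis .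
qed

text \<open>The two solution counts enter with the same sign, and their sum depends only on which
  coordinates vanish, so the quadratic equation drops out.\<close>

lemma torus_line_sum_B123_aux:
  assumes "x3 \<noteq> 0" and B: "B1 \<in> K'" "B2 \<in> K'" "B3 \<in> K'"
  shows "torus_sum (nrm x1) (nrm x2) (nrm x3) B1 B2 B3 + line_sum x1 x2 x3 B1 B2 B3 \<simeq>
    - 2 * of_bool (x1 \<noteq> 0) - 2 * of_bool (x2 \<noteq> 0) - 2 * of_bool (x3 \<noteq> 0)"
proof -
  define a where "a = B3 * nrm x3 - B1 * nrm x1 - B2 * nrm x2"
  define S where "S = int (card {v. nrm v = B1 / B2 \<and> B2 * tr (v * (x1 * cj x2)) = a})"
  define R where "R = int (card {e \<in> K'. B2 * nrm x1 * e ^ 2 - a * e + B1 * nrm x2 = 0})"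
  have "torus_sum (nrm x1) (nrm x2) (nrm x3) B1 B2 B3 + line_sum x1 x2 x3 B1 B2 B3 \<simeq>
      (- of_bool (nrm x1 \<noteq> 0) - of_bool (nrm x2 \<noteq> 0) - 3 - R) + (1 - S)"
    unfolding R_def S_def a_def
    by (intro cong_q_add torus_sum_scaled line_sum_scaled B) (use assms in auto)
  also have "\<dots> = - of_bool (x1 \<noteq> 0) - of_bool (x2 \<noteq> 0) - 2 - (S + R)" by simp
  also have "\<dots> \<simeq> - of_bool (x1 \<noteq> 0) - of_bool (x2 \<noteq> 0) - 2 - (of_bool (x1 \<noteq> 0) + of_bool (x2 \<noteq> 0))"
    using card_sum_scaled[OF assms, of x1 x2] unfolding R_def S_def a_def
    by (intro cong_q_diff cong_q_refl)
  also have "\<dots> = - 2 * of_bool (x1 \<noteq> 0) - 2 * of_bool (x2 \<noteq> 0) - 2 * of_bool (x3 \<noteq> 0)"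
    using assms(1) by simp
  finally show ?thesis .
qed

text \<open>Both sums are invariant under simultaneous permutations of coordinates and of
  \<open>B\<close>, so a nonzero coordinate may be moved to the third place; if there is none, both
  sums are 0.\<close>

lemma torus_line_sum_B123:
  assumes B: "B1 \<in> K'" "B2 \<in> K'" "B3 \<in> K'"
  shows "torus_sum (nrm x1) (nrm x2) (nrm x3) B1 B2 B3 + line_sum x1 x2 x3 B1 B2 B3 \<simeq>
    - 2 * of_bool (x1 \<noteq> 0) - 2 * of_bool (x2 \<noteq> 0) - 2 * of_bool (x3 \<noteq> 0)"
proof -
  consider "x3 \<noteq> 0" | "x2 \<noteq> 0" | "x1 \<noteq> 0" | "x1 = 0" "x2 = 0" "x3 = 0" by auto
  then show ?thesis
  proof cases
    case 1
    then show ?thesis using torus_line_sum_B123_aux B by blast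
  next
    case 2
    have "torus_sum (nrm x1) (nrm x3) (nrm x2) B1 B3 B2 + line_sum x1 x3 x2 B1 B3 B2 \<simeq>
        - 2 * of_bool (x1 \<noteq> 0) - 2 * of_bool (x3 \<noteq> 0) - 2 * of_bool (x2 \<noteq> 0)"
      using torus_line_sum_B123_aux[OF 2] B by blast
    then show ?thesis
      by (simp only: torus_sum_swap23[of "nrm x1"] line_sum_swap23[of x1]) (simp add: algebra_simps)
  next
    case 3
    have "torus_sum (nrm x2) (nrm x3) (nrm x1) B2 B3 B1 + line_sum x2 x3 x1 B2 B3 B1 \<simeq>
        - 2 * of_bool (x2 \<noteq> 0) - 2 * of_bool (x3 \<noteq> 0) - 2 * of_bool (x1 \<noteq> 0)"
      using torus_line_sum_B123_aux[OF 3] B by blast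
    then show ?thesis
      unfolding torus_sum_swap23[of "nrm x2" "nrm x3" "nrm x1" B2 B3 B1] line_sum_swap23[of x2 x3 x1 B2 B3 B1]
        torus_sum_swap12[of "nrm x2" "nrm x1" "nrm x3" B2 B1 B3] line_sum_swap12[of x2 x1 x3 B2 B1 B3]
      by (rule cong_q_eq_trans) simp
  next
    case 4
    then show ?thesis by (simp add: torus_sum_def line_sum_def)
  qed
qed

end

subsection \<open>From lines to Hermitian curves\<close>

context quadratic_extension
begin

text \<open>The trace left by the intersection numbers of a unital: every line misses a multiple of
  \<open>q\<close> of its points. Points enter through coordinate functions only, which makes linear
  changes of coordinates free; \<open>w = 0\<close> holds trivially.\<close>

definition meets_lines :: "'b set \<Rightarrow> ('b \<Rightarrow> 'a) \<Rightarrow> ('b \<Rightarrow> 'a) \<Rightarrow> ('b \<Rightarrow> 'a) \<Rightarrow> bool" where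
  "meets_lines U x1 x2 x3 \<longleftrightarrow>
     (\<forall>w1 w2 w3. (\<Sum>P\<in>U. of_bool (w1 * x1 P + w2 * x2 P + w3 * x3 P \<noteq> 0)) \<simeq> 0)"

lemma meets_linesD:
  "meets_lines U x1 x2 x3 \<Longrightarrow> (\<Sum>P\<in>U. of_bool (w1 * x1 P + w2 * x2 P + w3 * x3 P \<noteq> 0)) \<simeq> 0"
  unfolding meets_lines_def by blast

lemma meets_lines_swap12:
  assumes "meets_lines U x1 x2 x3"
  shows "meets_lines U x2 x1 x3"
  unfolding meets_lines_def
proof (intro allI)
  show "(\<Sum>P\<in>U. of_bool (w1 * x2 P + w2 * x1 P + w3 * x3 P \<noteq> 0)) \<simeq> 0" for w1 w2 w3
    using meets_linesD[OF assms, of w2 w1 w3] by (simp add: ac_simps)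
qed

lemma meets_lines_swap23:
  assumes "meets_lines U x1 x2 x3"
  shows "meets_lines U x1 x3 x2"
  unfolding meets_lines_def
proof (intro allI)
  show "(\<Sum>P\<in>U. of_bool (w1 * x1 P + w2 * x3 P + w3 * x2 P \<noteq> 0)) \<simeq> 0" for w1 w2 w3
    using meets_linesD[OF assms, of w1 w3 w2] by (simp add: ac_simps)
qed

lemma sum_coordinate_nonzero:
  assumes "meets_lines U x1 x2 x3"
  shows "(\<Sum>P\<in>U. of_bool (x1 P \<noteq> 0)) \<simeq> 0" "(\<Sum>P\<in>U. of_bool (x2 P \<noteq> 0)) \<simeq> 0"
    "(\<Sum>P\<in>U. of_bool (x3 P \<noteq> 0)) \<simeq> 0"
  using meets_linesD[OF assms, of 1 0 0] meets_linesD[OF assms, of 0 1 0] meets_linesD[OF assms, of 0 0 1]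
  by simp_all

lemma sum_line_sum:
  assumes "meets_lines U x1 x2 x3"
  shows "(\<Sum>P\<in>U. line_sum (x1 P) (x2 P) (x3 P) B1 B2 B3) \<simeq> 0"
proof -
  have "(\<Sum>P\<in>U. line_sum (x1 P) (x2 P) (x3 P) B1 B2 B3) =
      (\<Sum>w1 | nrm w1 = B1. \<Sum>w2 | nrm w2 = B2. \<Sum>w3 | nrm w3 = B3.
        \<Sum>P\<in>U. of_bool (w1 * x1 P + w2 * x2 P + w3 * x3 P \<noteq> 0))"
    unfolding line_sum_def
    by (subst sum.swap, rule sum.cong[OF refl], subst sum.swap, rule sum.cong[OF refl], rule sum.swap)
  also have "\<dots> \<simeq> (\<Sum>w1 | nrm w1 = B1. \<Sum>w2 | nrm w2 = B2. \<Sum>w3 | nrm w3 = B3. 0)"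
    by (intro cong_q_sum meets_linesD[OF assms])
  finally show ?thesis by simp
qed

text \<open>Line sums and coordinate counts both add up to 0 over \<open>U\<close>, so a pointwise
  relation with them eliminates the torus sums; \<open>e = 0\<close> serves the relation without
  line sums.\<close>

lemma sum_torus_sum_of_pointwise:
  assumes U: "meets_lines U x1 x2 x3"
    and pw: "\<And>P. torus_sum (nrm (x1 P)) (nrm (x2 P)) (nrm (x3 P)) B1 B2 B3
        + e * line_sum (x1 P) (x2 P) (x3 P) B1 B2 B3 \<simeq>
      - k * of_bool (x1 P \<noteq> 0) - l * of_bool (x2 P \<noteq> 0) - m * of_bool (x3 P \<noteq> 0)"
  shows "(\<Sum>P\<in>U. torus_sum (nrm (x1 P)) (nrm (x2 P)) (nrm (x3 P)) B1 B2 B3) \<simeq> 0"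
proof -
  let ?T = "\<lambda>P. torus_sum (nrm (x1 P)) (nrm (x2 P)) (nrm (x3 P)) B1 B2 B3"
  let ?L = "\<lambda>P. line_sum (x1 P) (x2 P) (x3 P) B1 B2 B3"
  have "(\<Sum>P\<in>U. ?T P) = (\<Sum>P\<in>U. ?T P + e * ?L P) - e * (\<Sum>P\<in>U. ?L P)"
    by (simp add: sum.distrib sum_distrib_left)
  also have "\<dots> \<simeq> (\<Sum>P\<in>U. - k * of_bool (x1 P \<noteq> 0) - l * of_bool (x2 P \<noteq> 0) - m * of_bool (x3 P \<noteq> 0)) - e * 0"
    by (intro cong_q_diff cong_q_sum pw cong_q_mult cong_q_refl sum_line_sum[OF U])
  also have "\<dots> = - k * (\<Sum>P\<in>U. of_bool (x1 P \<noteq> 0)) - l * (\<Sum>P\<in>U. of_bool (x2 P \<noteq> 0)) -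
      m * (\<Sum>P\<in>U. of_bool (x3 P \<noteq> 0))"
    by (simp add: sum_subtractf sum_distrib_left sum_negf)
  also have "\<dots> \<simeq> - k * 0 - l * 0 - m * 0"
    by (intro cong_q_diff cong_q_mult cong_q_refl sum_coordinate_nonzero[OF U])
  finally show ?thesis by simp
qed

lemma sum_torus_sum_B1:
  assumes "meets_lines U x1 x2 x3" "B1 \<in> K'"
  shows "(\<Sum>P\<in>U. torus_sum (nrm (x1 P)) (nrm (x2 P)) (nrm (x3 P)) B1 0 0) \<simeq> 0"
proof (rule sum_torus_sum_of_pointwise[OF assms(1), where e = 0 and k = 1 and l = 1 and m = 1])
  show "torus_sum (nrm (x1 P)) (nrm (x2 P)) (nrm (x3 P)) B1 0 0 + 0 * line_sum (x1 P) (x2 P) (x3 P) B1 0 0 \<simeq>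
      - 1 * of_bool (x1 P \<noteq> 0) - 1 * of_bool (x2 P \<noteq> 0) - 1 * of_bool (x3 P \<noteq> 0)" for P
    using torus_sum_B1[of "nrm (x1 P)" "nrm (x2 P)" "nrm (x3 P)" B1] assms(2) by simp
qed

lemma sum_torus_sum_B12:
  assumes "meets_lines U x1 x2 x3" "B1 \<in> K'" "B2 \<in> K'"
  shows "(\<Sum>P\<in>U. torus_sum (nrm (x1 P)) (nrm (x2 P)) (nrm (x3 P)) B1 B2 0) \<simeq> 0"
proof (rule sum_torus_sum_of_pointwise[OF assms(1), where e = 1 and k = 1 and l = 1 and m = 2])
  show "torus_sum (nrm (x1 P)) (nrm (x2 P)) (nrm (x3 P)) B1 B2 0 + 1 * line_sum (x1 P) (x2 P) (x3 P) B1 B2 0 \<simeq>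
      - 1 * of_bool (x1 P \<noteq> 0) - 1 * of_bool (x2 P \<noteq> 0) - 2 * of_bool (x3 P \<noteq> 0)" for P
    using torus_line_sum_B12[OF assms(2,3), of "x1 P" "x2 P" "x3 P"] by (simp only: mult_1 mult_minus1)
qed

lemma sum_torus_sum_B123:
  assumes "meets_lines U x1 x2 x3" "B1 \<in> K'" "B2 \<in> K'" "B3 \<in> K'"
  shows "(\<Sum>P\<in>U. torus_sum (nrm (x1 P)) (nrm (x2 P)) (nrm (x3 P)) B1 B2 B3) \<simeq> 0"
proof (rule sum_torus_sum_of_pointwise[OF assms(1), where e = 1 and k = 2 and l = 2 and m = 2])
  show "torus_sum (nrm (x1 P)) (nrm (x2 P)) (nrm (x3 P)) B1 B2 B3 + 1 * line_sum (x1 P) (x2 P) (x3 P) B1 B2 B3 \<simeq>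
      - 2 * of_bool (x1 P \<noteq> 0) - 2 * of_bool (x2 P \<noteq> 0) - 2 * of_bool (x3 P \<noteq> 0)" for P
    using torus_line_sum_B123[OF assms(2-4), of "x1 P" "x2 P" "x3 P"] by (simp only: mult_1)
qed

text \<open>In the application \<open>B\<close> consists of multiples of coordinate norms and may
  have zero entries. Its zero pattern, up to a permutation of coordinates, selects the pointwise
  identity.\<close>

lemma sum_torus_sum:
  assumes U: "meets_lines U x1 x2 x3" and B: "B1 \<in> K" "B2 \<in> K" "B3 \<in> K"
  shows "(\<Sum>P\<in>U. torus_sum (nrm (x1 P)) (nrm (x2 P)) (nrm (x3 P)) B1 B2 B3) \<simeq> 0"
proof -
  have U213: "meets_lines U x2 x1 x3" using U by (rule meets_lines_swap12)
  have U132: "meets_lines U x1 x3 x2" using U by (rule meets_lines_swap23)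
  have U231: "meets_lines U x2 x3 x1" using U213 by (rule meets_lines_swap23)
  have U312: "meets_lines U x3 x1 x2" using U132 by (rule meets_lines_swap12)
  have e132: "torus_sum A1 A3 A2 B1 B3 B2 = torus_sum A1 A2 A3 B1 B2 B3" for A1 A2 A3
    by (rule torus_sum_swap23)
  have e213: "torus_sum A2 A1 A3 B2 B1 B3 = torus_sum A1 A2 A3 B1 B2 B3" for A1 A2 A3
    by (rule torus_sum_swap12)
  have e231: "torus_sum A2 A3 A1 B2 B3 B1 = torus_sum A1 A2 A3 B1 B2 B3" for A1 A2 A3
    by (rule trans[OF torus_sum_swap23 torus_sum_swap12])
  have e312: "torus_sum A3 A1 A2 B3 B1 B2 = torus_sum A1 A2 A3 B1 B2 B3" for A1 A2 A3
    by (rule trans[OF torus_sum_swap12 torus_sum_swap23])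
  consider "B1 = 0" "B2 = 0" "B3 = 0" | "B1 \<noteq> 0" "B2 = 0" "B3 = 0" | "B1 = 0" "B2 \<noteq> 0" "B3 = 0"
    | "B1 = 0" "B2 = 0" "B3 \<noteq> 0" | "B1 \<noteq> 0" "B2 \<noteq> 0" "B3 = 0" | "B1 \<noteq> 0" "B2 = 0" "B3 \<noteq> 0"
    | "B1 = 0" "B2 \<noteq> 0" "B3 \<noteq> 0" | "B1 \<noteq> 0" "B2 \<noteq> 0" "B3 \<noteq> 0"
    by blast
  then show ?thesis
  proof cases
    case 1
    then show ?thesis by (simp add: torus_sum_def)
  next
    case 2
    then show ?thesis using sum_torus_sum_B1[OF U, of B1] B by simp
  next
    case 3
    then show ?thesis using sum_torus_sum_B1[OF U213, of B2] B unfolding e213[symmetric] by simp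
  next
    case 4
    then show ?thesis using sum_torus_sum_B1[OF U312, of B3] B unfolding e312[symmetric] by simp
  next
    case 5
    then show ?thesis using sum_torus_sum_B12[OF U, of B1 B2] B by simp
  next
    case 6
    then show ?thesis using sum_torus_sum_B12[OF U132, of B1 B3] B unfolding e132[symmetric] by simp
  next
    case 7
    then show ?thesis using sum_torus_sum_B12[OF U231, of B2 B3] B unfolding e231[symmetric] by simp
  next
    case 8
    then show ?thesis using sum_torus_sum_B123[OF U, of B1 B2 B3] B by simp
  qed
qed

section \<open>Fourier analysis on the torus and extraction of the square root\<close>

lemma sum_powers_K':
  assumes "x \<in> K'"
  shows "(\<Sum>a<q - 1. x ^ a) = (if x = 1 then - 1 else 0)"
proof -
  have "x * x ^ (q - 1) = x * 1"
    using assms q_pos by (simp add: K_def flip: power_Suc)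
  then have "x ^ (q - 1) = 1" using assms by (metis DiffD2 insertI1 mult_left_cancel)
  \<comment> \<open>At \<open>x = 1\<close> the sum has \<open>q - 1\<close> terms equal to 1. This
    is character orthogonality with values in the field itself.\<close>
  moreover have "of_nat (q - 1) = (- 1 :: 'a)"
    using q_pos by (simp add: of_nat_diff)
  ultimately show ?thesis by (simp add: geometric_sum)
qed

text \<open>The group algebra of \<open>K'\<^sup>3\<close> modulo \<open>p\<close> is reduced, since the group exponent \<open>q - 1\<close> is prime
  to \<open>p\<close>; concretely, the discrete Fourier transform with values in the field itself is injective
  and turns convolution into multiplication.\<close>

lemma dvd_of_dvd_self_convolution:
  fixes h :: "'a \<times> 'a \<times> 'a \<Rightarrow> int"
  defines "T \<equiv> K' \<times> K' \<times> K'"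
  defines "dv \<equiv> \<lambda>(a, b, c) (d, e, f). (a / d, b / e, c / f)"
  assumes conv: "\<And>E. E \<in> T \<Longrightarrow> int p dvd (\<Sum>D\<in>T. h D * h (dv E D))"
    and E: "E \<in> T"
  shows "int p dvd h E"
proof -
  \<comment> \<open>The exponent triples in \<open>I\<close> index the characters
    \<open>ch n\<close> of the torus; \<open>dv\<close> is division in the torus.\<close>
  define I where "I = {..<q - 1} \<times> {..<q - 1} \<times> {..<q - 1}"
  define ch where "ch = (\<lambda>(a, b, c) (x, y, z). x ^ a * y ^ b * z ^ c :: 'a)"
  have of_int_eq_0: "of_int m = (0::'a) \<longleftrightarrow> int p dvd m" for m
    using of_int_eq_0_iff_char_dvd[of m, where 'a='a] CHAR_F by simp
  have ch_dv': "ch n (dv X Y) = ch n X * ch n (dv (1, 1, 1) Y)" for n X Y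
    by (auto simp: dv_def ch_def power_divide split: prod.splits)
  \<comment> \<open>The square of the transform of \<open>h\<close> is the transform of
    \<open>h * h\<close>, which vanishes modulo \<open>p\<close>; a field has no nilpotents.\<close>
  have hat_0: "(\<Sum>D\<in>T. of_int (h D) * ch n D) = 0" for n
  proof -
    have "(\<Sum>D\<in>T. of_int (h D) * ch n D) * (\<Sum>D\<in>T. of_int (h D) * ch n D) =
        (\<Sum>D\<in>T. \<Sum>D'\<in>T. of_int (h D * h D') * (ch n D * ch n D'))"
      by (simp add: sum_product mult_ac)
    also have "\<dots> = (\<Sum>D\<in>T. \<Sum>E\<in>T. of_int (h D * h (dv E D)) * ch n E)"
    proof (rule sum.cong[OF refl])
      fix D assume D: "D \<in> T"
      define m where "m = (\<lambda>(a, b, c). case D of (d, e, f) \<Rightarrow> (a * d, b * e, c * f))"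
      show "(\<Sum>D'\<in>T. of_int (h D * h D') * (ch n D * ch n D')) =
          (\<Sum>E\<in>T. of_int (h D * h (dv E D)) * ch n E)"
      proof (rule sum.reindex_bij_witness[of _ "\<lambda>E. dv E D" m])
        show "dv (m D') D = D'" "m D' \<in> T" if "D' \<in> T" for D'
          using that D by (auto simp: m_def dv_def T_def)
        show "m (dv E D) = E" "dv E D \<in> T" if "E \<in> T" for E
          using that D by (auto simp: m_def dv_def T_def)
        show "of_int (h D * h (dv (m D') D)) * ch n (m D') = of_int (h D * h D') * (ch n D * ch n D')"
          if "D' \<in> T" for D'
          using that D by (auto simp: m_def dv_def T_def ch_def power_mult_distrib split: prod.splits)
      qed
    qed
    also have "\<dots> = (\<Sum>E\<in>T. of_int (\<Sum>D\<in>T. h D * h (dv E D)) * ch n E)"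
      by (subst sum.swap) (simp add: sum_distrib_right)
    also have "\<dots> = 0"
      using conv of_int_eq_0 by (intro sum.neutral) (simp del: of_int_sum)
    finally show ?thesis by simp
  qed
  have orth: "(\<Sum>n\<in>I. ch n (dv D E)) = (if D = E then - 1 else 0)" if D: "D \<in> T" for D
  proof -
    obtain d1 d2 d3 where D': "D = (d1, d2, d3)" by (cases D)
    obtain e1 e2 e3 where E': "E = (e1, e2, e3)" by (cases E)
    have K: "d1 / e1 \<in> K'" "d2 / e2 \<in> K'" "d3 / e3 \<in> K'"
      using D E by (auto simp: T_def D' E')
    have "(\<Sum>n\<in>I. ch n (dv D E)) =
        (\<Sum>a<q - 1. (d1 / e1) ^ a) * ((\<Sum>b<q - 1. (d2 / e2) ^ b) * (\<Sum>c<q - 1. (d3 / e3) ^ c))"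
      unfolding I_def sum.cartesian_product' sum_product unfolding sum_distrib_left
      by (simp add: ch_def dv_def D' E' mult.assoc)
    also have "\<dots> = (if D = E then - 1 else 0)"
      unfolding sum_powers_K'[OF K(1)] sum_powers_K'[OF K(2)] sum_powers_K'[OF K(3)]
      using D E by (auto simp: T_def D' E')
    finally show ?thesis .
  qed
  \<comment> \<open>Fourier inversion: since \<open>(q - 1) ^ 3\<close> is \<open>-1\<close> in the
    field, the inverse transform returns \<open>- h E\<close>.\<close>
  have "0 = (\<Sum>n\<in>I. (\<Sum>D\<in>T. of_int (h D) * ch n D) * ch n (dv (1, 1, 1) E))"
    by (simp add: hat_0)
  also have "\<dots> = (\<Sum>n\<in>I. \<Sum>D\<in>T. of_int (h D) * ch n (dv D E))"
    by (simp add: sum_distrib_right mult.assoc flip: ch_dv')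
  also have "\<dots> = (\<Sum>D\<in>T. of_int (h D) * (\<Sum>n\<in>I. ch n (dv D E)))"
    by (subst sum.swap) (simp add: sum_distrib_left)
  also have "\<dots> = (\<Sum>D\<in>T. if D = E then - of_int (h D) else 0)"
    by (intro sum.cong refl) (simp add: orth)
  also have "\<dots> = - of_int (h E)"
    using E by (simp add: T_def)
  finally show ?thesis using of_int_eq_0 by simp
qed

text \<open>Once \<open>p ^ j\<close> divides \<open>h\<close>, dividing it out costs the
  convolution \<open>p ^ (2 * j)\<close>. As long as \<open>2 * j + 1 \<le> n\<close> a factor
  \<open>p\<close> is left over, and the reduced case gives one more factor of
  \<open>h\<close>.\<close>

lemma power_dvd_of_dvd_self_convolution:
  fixes h :: "'a \<times> 'a \<times> 'a \<Rightarrow> int"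
  defines "T \<equiv> K' \<times> K' \<times> K'"
  defines "dv \<equiv> \<lambda>(a, b, c) (d, e, f). (a / d, b / e, c / f)"
  assumes conv: "\<And>E. E \<in> T \<Longrightarrow> int (p ^ n) dvd (\<Sum>D\<in>T. h D * h (dv E D))"
    and E: "E \<in> T" and j: "j \<le> (n + 1) div 2"
  shows "int (p ^ j) dvd h E"
  using j E
proof (induction j arbitrary: E)
  case 0
  then show ?case by simp
next
  case (Suc j)
  have pos: "int (p ^ j) \<noteq> 0" using prime_p by auto
  define h0 where "h0 D = h D div int (p ^ j)" for D
  have h: "h D = int (p ^ j) * h0 D" if "D \<in> T" for D
    using Suc.IH[OF _ that] Suc.prems(1) by (simp add: h0_def)
  have "int p dvd (\<Sum>D\<in>T. h0 D * h0 (dv X D))" if X: "X \<in> T" for X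
  proof -
    have dvT: "dv X D \<in> T" if "D \<in> T" for D
      using that X by (auto simp: T_def dv_def)
    have "int (p ^ (2 * j)) * int p dvd int (p ^ n)"
    proof -
      have "2 * j + 1 \<le> n" using Suc.prems(1) by simp
      then have "p ^ (2 * j + 1) dvd p ^ n" by (rule le_imp_power_dvd)
      then have "int (p ^ (2 * j + 1)) dvd int (p ^ n)" by (simp only: of_nat_dvd_iff)
      then show ?thesis by (simp add: mult.commute)
    qed
    also have "int (p ^ n) dvd (\<Sum>D\<in>T. h D * h (dv X D))" by (rule conv[OF X])
    also have "\<dots> = (\<Sum>D\<in>T. int (p ^ (2 * j)) * (h0 D * h0 (dv X D)))"
      by (intro sum.cong refl) (simp add: h dvT mult_2 power_add)
    also have "\<dots> = int (p ^ (2 * j)) * (\<Sum>D\<in>T. h0 D * h0 (dv X D))"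
      by (rule sum_distrib_left[symmetric])
    finally show ?thesis using prime_p by (simp add: dvd_mult_cancel_left)
  qed
  then have "int p dvd h0 E"
    using dvd_of_dvd_self_convolution[of h0 E] Suc.prems(2) unfolding T_def dv_def by blast
  then show ?case using h[OF Suc.prems(2)] by (simp add: mult.commute)
qed

text \<open>Expanding the convolution of the counting function over pairs of points of
  \<open>U\<close> gives torus sums; for each fixed second point these add up to 0 modulo
  \<open>q = p ^ t\<close>.\<close>

lemma diagonal_count_dvd:
  assumes U: "meets_lines U x1 x2 x3" and d: "d1 \<in> K'" "d2 \<in> K'" "d3 \<in> K'"
  shows "int (p ^ ((t + 1) div 2)) dvd
    (\<Sum>P\<in>U. of_bool (d1 * nrm (x1 P) + d2 * nrm (x2 P) + d3 * nrm (x3 P) \<noteq> 0))"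
proof -
  define h :: "'a \<times> 'a \<times> 'a \<Rightarrow> int" where
    "h = (\<lambda>(d1, d2, d3). \<Sum>P\<in>U. of_bool (d1 * nrm (x1 P) + d2 * nrm (x2 P) + d3 * nrm (x3 P) \<noteq> 0))"
  have "int (p ^ ((t + 1) div 2)) dvd h (d1, d2, d3)"
  proof (rule power_dvd_of_dvd_self_convolution[where n = t])
    fix E :: "'a \<times> 'a \<times> 'a" assume "E \<in> K' \<times> K' \<times> K'"
    then obtain e1 e2 e3 where E: "E = (e1, e2, e3)" "e1 \<in> K'" "e2 \<in> K'" "e3 \<in> K'" by auto
    have "(\<Sum>D\<in>K' \<times> K' \<times> K'. h D * h ((\<lambda>(a, b, c) (d, e, f). (a / d, b / e, c / f)) E D)) =
        (\<Sum>P'\<in>U. \<Sum>P\<in>U. torus_sum (nrm (x1 P)) (nrm (x2 P)) (nrm (x3 P))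
          (e1 * nrm (x1 P')) (e2 * nrm (x2 P')) (e3 * nrm (x3 P')))"
    proof -
      have "(\<Sum>D\<in>K' \<times> K' \<times> K'. h D * h ((\<lambda>(a, b, c) (d, e, f). (a / d, b / e, c / f)) E D)) =
        (\<Sum>D\<in>K' \<times> K' \<times> K'. \<Sum>P\<in>U. \<Sum>P'\<in>U. (case D of (d1, d2, d3) \<Rightarrow>
          of_bool (d1 * nrm (x1 P) + d2 * nrm (x2 P) + d3 * nrm (x3 P) \<noteq> 0 \<and>
            e1 * nrm (x1 P') / d1 + e2 * nrm (x2 P') / d2 + e3 * nrm (x3 P') / d3 \<noteq> 0)))"
        by (intro sum.cong refl)
          (auto simp: h_def E(1) sum_product of_bool_conj split: prod.splits)
      also have "\<dots> = (\<Sum>P\<in>U. \<Sum>P'\<in>U. \<Sum>D\<in>K' \<times> K' \<times> K'. (case D of (d1, d2, d3) \<Rightarrow>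
          of_bool (d1 * nrm (x1 P) + d2 * nrm (x2 P) + d3 * nrm (x3 P) \<noteq> 0 \<and>
            e1 * nrm (x1 P') / d1 + e2 * nrm (x2 P') / d2 + e3 * nrm (x3 P') / d3 \<noteq> 0)))"
        by (subst sum.swap, rule sum.cong[OF refl], rule sum.swap)
      also have "\<dots> = (\<Sum>P'\<in>U. \<Sum>P\<in>U. \<Sum>D\<in>K' \<times> K' \<times> K'. (case D of (d1, d2, d3) \<Rightarrow>
          of_bool (d1 * nrm (x1 P) + d2 * nrm (x2 P) + d3 * nrm (x3 P) \<noteq> 0 \<and>
            e1 * nrm (x1 P') / d1 + e2 * nrm (x2 P') / d2 + e3 * nrm (x3 P') / d3 \<noteq> 0)))"
        by (rule sum.swap)
      finally show ?thesis
        unfolding torus_sum_def sum.cartesian_product' by simp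
    qed
    also have "\<dots> \<simeq> (\<Sum>P'\<in>U. 0)"
      using E by (intro cong_q_sum sum_torus_sum[OF U]) auto
    finally show "int (p ^ t) dvd (\<Sum>D\<in>K' \<times> K' \<times> K'. h D * h ((\<lambda>(a, b, c) (d, e, f). (a / d, b / e, c / f)) E D))"
      by (simp only: cong_q_dvd_iff sum.neutral_const diff_zero flip: q_eq)
  qed (use d in auto)
  then show ?thesis by (simp add: h_def)
qed

end

subsection \<open>Affine conics and Buekenhout--Metz counts\<close>

context quadratic_extension
begin

lemma sum_UNIV_scale:
  assumes "s \<noteq> (0::'a)"
  shows "(\<Sum>v\<in>UNIV. f (s * v)) = (\<Sum>v\<in>UNIV. f v)"
  by (rule sum.reindex_bij_witness[of _ "\<lambda>v. v / s" "\<lambda>v. s * v"]) (use assms in auto)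

lemma sum_UNIV_shift: "(\<Sum>v\<in>UNIV. f (x + v)) = (\<Sum>v\<in>UNIV. f (v::'a))"
  by (rule sum.reindex_bij_witness[of _ "\<lambda>v. v - x" "\<lambda>v. x + v"]) auto

lemma int_card_UNIV: "int CARD('a) = int q * int q"
  by (simp add: card_F power2_eq_square)

lemma sum_tr_nonzero: "(\<Sum>v\<in>UNIV. of_bool (tr (j * v) \<noteq> 0)) \<simeq> 0"
proof (cases "j = 0")
  case True
  then show ?thesis by (simp add: tr_def)
next
  case False
  have "(\<Sum>v\<in>UNIV. of_bool (tr (j * v) \<noteq> 0)) = (\<Sum>v\<in>UNIV. 1 - of_bool (tr (j * v) = 0) :: int)"
    by (simp add: of_bool_not_iff)
  also have "\<dots> = int q * int q - int q"
    using card_tr_scaled_fibre[of 0 j] False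
    by (simp add: sum_subtractf card_F sum_of_bool_card power2_eq_square)
  finally show ?thesis by (simp add: cong_q_dvd_iff)
qed

text \<open>For \<open>k3\<close> in \<open>K\<close> this is a binary quadratic form over
  \<open>K\<close>, the field being regarded as a plane over \<open>K\<close>.\<close>

definition quad :: "'a \<Rightarrow> 'a \<Rightarrow> 'a \<Rightarrow> 'a" where
  "quad k2 k3 y = tr (k2 * y ^ 2) + k3 * nrm y"

lemma quad_K [simp]: "k3 \<in> K \<Longrightarrow> quad k2 k3 y \<in> K"
  by (simp add: quad_def)

lemma quad_add_scaled:
  assumes "k3 \<in> K" "s \<in> K"
  shows "quad k2 k3 (x + s * v) = quad k2 k3 x + s * tr ((2 * k2 * x + k3 * cj x) * v) + s ^ 2 * quad k2 k3 v"
  using assms by (simp add: quad_def tr_def nrm_def power2_eq_square algebra_simps)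

text \<open>From a point \<open>x\<close> of the level set look along each direction
  \<open>v\<close>: the level is met again at \<open>s \<noteq> 0\<close> when
  \<open>tr (j * v) + s * quad k2 k3 v = 0\<close>. Summed over \<open>v\<close>, the linear part
  contributes 0 modulo \<open>q\<close>, leaving the zeros of the quadratic part.\<close>

lemma card_affine_quad_attained:
  assumes K: "k0 \<in> K" "k3 \<in> K" and x: "k0 + tr (k1 * x) + quad k2 k3 x = d"
  shows "int (card {y. k0 + tr (k1 * y) + quad k2 k3 y = d}) \<simeq> int (card {y. quad k2 k3 y = 0})"
proof -
  define R where "R y = k0 + tr (k1 * y) + quad k2 k3 y" for y
  define j where "j = k1 + (2 * k2 * x + k3 * cj x)"
  have R_add: "R (x + s * v) = d + s * (tr (j * v) + s * quad k2 k3 v)" if "s \<in> K" for s v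
    using that x K by (simp add: R_def quad_add_scaled j_def)
      (simp add: tr_def power2_eq_square algebra_simps)
  \<comment> \<open>For each fixed \<open>s\<close> the points \<open>x + s * v\<close> run once
    through the field, so the level set is counted \<open>card K'\<close> times.\<close>
  have "int (card K') * int (card {y. R y = d}) = (\<Sum>s\<in>K'. \<Sum>v\<in>UNIV. of_bool (R (x + s * v) = d))"
  proof -
    have "(\<Sum>v\<in>UNIV. of_bool (R (x + s * v) = d)) = int (card {y. R y = d})" if "s \<in> K'" for s
      using that sum_UNIV_scale[of s "\<lambda>v. of_bool (R (x + v) = d) :: int"]
        sum_UNIV_shift[of "\<lambda>v. of_bool (R v = d) :: int" x]
      by (simp add: sum_of_bool_card)
    then show ?thesis by simp
  qed
  also have "\<dots> = (\<Sum>v\<in>UNIV. \<Sum>s\<in>K'. of_bool (R (x + s * v) = d))"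
    by (rule sum.swap)
  also have "\<dots> = (\<Sum>v\<in>UNIV. int (card K') - (\<Sum>s\<in>K'. of_bool (s * quad k2 k3 v + tr (j * v) \<noteq> 0)))"
  proof (rule sum.cong[OF refl])
    fix v
    have "(\<Sum>s\<in>K'. of_bool (R (x + s * v) = d)) =
        (\<Sum>s\<in>K'. 1 - of_bool (s * quad k2 k3 v + tr (j * v) \<noteq> 0) :: int)"
      by (intro sum.cong) (auto simp: R_add add.commute)
    then show "(\<Sum>s\<in>K'. of_bool (R (x + s * v) = d)) =
        int (card K') - (\<Sum>s\<in>K'. of_bool (s * quad k2 k3 v + tr (j * v) \<noteq> 0))"
      by (simp only: sum_subtractf sum_constant)
  qed
  also have "\<dots> \<simeq> (\<Sum>v\<in>UNIV. - 1 - (- of_bool (quad k2 k3 v \<noteq> 0) - of_bool (tr (j * v) \<noteq> 0)))"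
    using K by (intro cong_q_sum cong_q_diff card_K'_cong sum_K'_affine_nonzero) auto
  also have "\<dots> = (\<Sum>v\<in>UNIV. of_bool (tr (j * v) \<noteq> 0) - of_bool (quad k2 k3 v = 0))"
    by (intro sum.cong) auto
  also have "\<dots> = (\<Sum>v\<in>UNIV. of_bool (tr (j * v) \<noteq> 0)) - int (card {y. quad k2 k3 y = 0})"
    by (simp add: sum_subtractf sum_of_bool_card)
  also have "\<dots> \<simeq> 0 - int (card {y. quad k2 k3 y = 0})"
    by (intro cong_q_diff sum_tr_nonzero cong_q_refl)
  finally have 1: "int (card K') * int (card {y. R y = d}) \<simeq> 0 - int (card {y. quad k2 k3 y = 0})" .
  have "int (card K') * int (card {y. R y = d}) \<simeq> - 1 * int (card {y. R y = d})"
    by (intro cong_q_mult card_K'_cong cong_q_refl)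
  from cong_q_trans[OF cong_q_sym[OF this] 1] show ?thesis
    unfolding R_def using cong_q_minus by fastforce
qed

lemma bij_betw_basis:
  assumes "v1 \<noteq> 0" and "v2 \<notin> (\<lambda>a. a * v1) ` K"
  shows "bij_betw (\<lambda>(a, b). a * v1 + b * v2) (K \<times> K) (UNIV :: 'a set)"
proof -
  have inj: "inj_on (\<lambda>(a, b). a * v1 + b * v2) (K \<times> K)"
  proof (rule inj_onI, clarify)
    fix a b c d assume K: "a \<in> K" "b \<in> K" "c \<in> K" "d \<in> K" and eq: "a * v1 + b * v2 = c * v1 + d * v2"
    show "a = c \<and> b = d"
    proof (cases "b = d")
      case False
      have "(b - d) * v2 = (c - a) * v1"
        using arg_cong[OF eq, of "\<lambda>x. x - a * v1 - d * v2"] by (simp add: left_diff_distrib)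
      then have "v2 = (c - a) / (b - d) * v1"
        using False by (simp add: eq_divide_eq mult.commute)
      moreover have "(c - a) / (b - d) \<in> K" using K by simp
      ultimately have "v2 \<in> (\<lambda>a. a * v1) ` K" by (rule image_eqI)
      with assms(2) show ?thesis by contradiction
    qed (use eq assms(1) in simp)
  qed
  then have "card ((\<lambda>(a, b). a * v1 + b * v2) ` (K \<times> K)) = CARD('a)"
    by (simp add: card_image card_F power2_eq_square)
  then have "(\<lambda>(a, b). a * v1 + b * v2) ` (K \<times> K) = UNIV"
    by (intro card_subset_eq) auto
  with inj show ?thesis by (simp add: bij_betw_def)
qed

text \<open>The zeros are the origin, one \<open>K\<close>-line, two \<open>K\<close>-lines or
  everything, that is 1, \<open>q\<close>, \<open>2 * q - 1\<close> or \<open>q ^ 2\<close> points.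
  Divisibility by \<open>p\<close> rules out the first and third case.\<close>

lemma card_quad_zeros:
  assumes K: "k3 \<in> K" and p: "p dvd card {y. quad k2 k3 y = 0}"
  shows "int (card {y. quad k2 k3 y = 0}) \<simeq> 0"
proof -
  let ?Z = "{y. quad k2 k3 y = 0}"
  have scale: "quad k2 k3 (s * v) = s ^ 2 * quad k2 k3 v" if "s \<in> K" for s v
    using quad_add_scaled[OF K that, of k2 0 v] by (simp add: quad_def tr_def)
  have "?Z \<noteq> {0}" using p prime_p by auto
  then obtain v1 where v1: "v1 \<noteq> 0" "quad k2 k3 v1 = 0"
    using scale[of 0 0] by auto
  show ?thesis
  proof (cases "?Z \<subseteq> (\<lambda>a. a * v1) ` K")
    case True
    then have "?Z = (\<lambda>a. a * v1) ` K" using scale v1 by auto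
    moreover have "inj_on (\<lambda>a. a * v1) K" using v1 by (auto intro: inj_onI)
    ultimately have "card ?Z = q" by (simp add: card_image)
    then show ?thesis by (simp add: cong_q_dvd_iff)
  next
    case False
    then obtain v2 where v2: "quad k2 k3 v2 = 0" "v2 \<notin> (\<lambda>a. a * v1) ` K" by auto
    \<comment> \<open>\<open>w\<close> is the value of the polar form at two isotropic basis
      vectors, so the form becomes \<open>a * b * w\<close>.\<close>
    define w where "w = tr ((2 * k2 * v1 + k3 * cj v1) * v2)"
    have ab: "quad k2 k3 (a * v1 + b * v2) = a * b * w" if "a \<in> K" "b \<in> K" for a b
    proof -
      have "tr ((2 * k2 * (a * v1) + k3 * cj (a * v1)) * v2) = a * w"
        using that by (simp add: w_def tr_def algebra_simps)
      then show ?thesis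
        using quad_add_scaled[OF K that(2), of k2 "a * v1" v2] scale[OF that(1)] v1 v2 by simp
    qed
    note basis = bij_betw_basis[OF v1(1) v2(2)]
    have bij: "bij_betw (\<lambda>(a, b). a * v1 + b * v2) {(a, b) \<in> K \<times> K. a * b * w = 0} ?Z"
    proof (rule bij_betw_subset[OF basis])
      show "(\<lambda>(a, b). a * v1 + b * v2) ` {(a, b) \<in> K \<times> K. a * b * w = 0} = ?Z"
      proof (intro equalityI subsetI)
        fix y assume "y \<in> (\<lambda>(a, b). a * v1 + b * v2) ` {(a, b) \<in> K \<times> K. a * b * w = 0}"
        then obtain a b where "a \<in> K" "b \<in> K" "a * b * w = 0" "y = a * v1 + b * v2"
          by (elim imageE) (auto simp del: mult_eq_0_iff)
        then show "y \<in> ?Z" using ab[of a b] by simp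
      next
        fix y assume y: "y \<in> ?Z"
        have "y \<in> (\<lambda>(a, b). a * v1 + b * v2) ` (K \<times> K)"
          unfolding bij_betw_imp_surj_on[OF basis] by simp
        then obtain a b where *: "a \<in> K" "b \<in> K" "y = a * v1 + b * v2"
          by (elim imageE) auto
        then have "a * b * w = 0" using ab[of a b] y by simp
        with * show "y \<in> (\<lambda>(a, b). a * v1 + b * v2) ` {(a, b) \<in> K \<times> K. a * b * w = 0}"
          by (intro image_eqI[of _ _ "(a, b)"]) auto
      qed
    qed auto
    show ?thesis
    proof (cases "w = 0")
      case True
      then have "{(a, b) \<in> K \<times> K. a * b * w = 0} = K \<times> K" by auto
      then have "card ?Z = q * q"
        unfolding bij_betw_same_card[OF bij, symmetric] by (simp only: card_cartesian_product card_K)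
      then show ?thesis by (simp add: cong_q_dvd_iff)
    next
      case False
      then have *: "{(a, b) \<in> K \<times> K. a * b * w = 0} = {0} \<times> K \<union> K' \<times> {0}" by auto
      have "card ({0} \<times> K \<union> K' \<times> {0}) = card ({0::'a} \<times> K) + card (K' \<times> {0::'a})"
        by (rule card_Un_disjoint) auto
      then have "card ?Z = q + (q - 1)"
        unfolding bij_betw_same_card[OF bij, symmetric] * by (simp add: card_cartesian_product)
      then have "p dvd 2 * q - 1" using p q_pos by (simp add: mult_2)
      moreover have "p dvd 2 * q" using t_pos by (simp add: q_eq)
      moreover have "2 * q = (2 * q - 1) + 1" using q_pos by simp
      ultimately have "p dvd 1" by (metis dvd_add_right_iff)
      then show ?thesis using prime_p by auto
    qed
  qed
qed

text \<open>If the value 0 is not attained, the attained levels all have size congruent to that of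
  the zero set of \<open>quad\<close>, and their number lies strictly between 0 and
  \<open>q\<close>. As the sizes add up to \<open>q ^ 2\<close>, the prime \<open>p\<close> divides
  that size, which is then 0 modulo \<open>q\<close> like the empty level.\<close>

lemma card_affine_quad_zeros:
  assumes K: "k0 \<in> K" "k3 \<in> K"
  shows "int (card {y. k0 + tr (k1 * y) + quad k2 k3 y = 0}) \<simeq> int (card {y. quad k2 k3 y = 0})"
proof (cases "\<exists>x. k0 + tr (k1 * x) + quad k2 k3 x = 0")
  case True
  then show ?thesis using card_affine_quad_attained[OF K] by blast
next
  case False
  define R where "R y = k0 + tr (k1 * y) + quad k2 k3 y" for y
  define D where "D = range R"
  define z where "z = card {y. quad k2 k3 y = 0}"
  have D: "D \<subseteq> K'" using False K by (auto simp: D_def R_def)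
  then have "card D \<le> q - 1" using card_mono[of K' D] by simp
  moreover have "card D > 0" by (simp add: D_def card_gt_0_iff)
  ultimately have not_dvd: "\<not> q dvd card D" using q_gt_1 by (auto dest: dvd_imp_le)
  have "CARD('a) = (\<Sum>d\<in>D. card {y. R y = d})"
    using card_fibres[of UNIV D R] by (simp add: D_def)
  then have "int q * int q = (\<Sum>d\<in>D. int (card {y. R y = d}))"
    using int_card_UNIV by simp
  also have "\<dots> \<simeq> (\<Sum>d\<in>D. int z)"
    unfolding z_def by (intro cong_q_sum) (auto simp: D_def R_def intro: card_affine_quad_attained[OF K])
  finally have "int q dvd int q * int q - int (card D * z)" by (simp add: cong_q_dvd_iff)
  then have "int q dvd int (card D * z)" by (metis dvd_diff_right_iff dvd_triv_left)
  then have "q dvd card D * z" by (simp only: of_nat_dvd_iff)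
  then have "\<not> coprime q z" using not_dvd coprime_dvd_mult_left_iff by blast
  then have "p dvd z"
    unfolding q_eq using prime_p by (metis coprime_power_left_iff prime_imp_coprime)
  then have "int z \<simeq> 0" using card_quad_zeros[OF K(2)] by (simp add: z_def)
  moreover have "{y. k0 + tr (k1 * y) + quad k2 k3 y = 0} = {}" using False by auto
  ultimately show ?thesis by (simp only: card.empty z_def) (simp add: cong_q_sym)
qed

section \<open>Circles, lines and the pencils they span\<close>

lemma card_hermitian_circle:
  assumes "m \<in> K'" and "k \<in> K"
  shows "int (card {z. m * nrm z + tr (z * l) + k = 0}) = int q + 1 - int q * of_bool (nrm l = m * k)"
proof -
  have "m * nrm z + tr (z * l) + k = 0 \<longleftrightarrow> nrm (m * z + cj l) = nrm l - m * k" for z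
  proof -
    \<comment> \<open>Completing the square after multiplication by \<open>m\<close> turns the
      circle into a norm fibre.\<close>
    have "nrm (m * z + cj l) - (nrm l - m * k) = m * (m * nrm z + tr (z * l) + k)"
      using assms by (simp add: nrm_def tr_def algebra_simps)
    then show ?thesis using assms by (metis DiffE insertI1 eq_iff_diff_eq_0 mult_eq_0_iff)
  qed
  then have "card {z. m * nrm z + tr (z * l) + k = 0} = card {z. nrm (m * z + cj l) = nrm l - m * k}"
    by simp
  also have "\<dots> = card {u. nrm u = nrm l - m * k}"
    by (rule bij_betw_same_card[of "\<lambda>z. m * z + cj l"], rule bij_betw_byWitness[where f' = "\<lambda>u. (u - cj l) / m"])
       (use assms in auto)
  also have "int \<dots> = int q + 1 - int q * of_bool (nrm l = m * k)"
    using assms by (cases "nrm l = m * k") (simp_all)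
  finally show ?thesis .
qed

text \<open>Averaging over the pencil \<open>m N(z) + Tr(l z) + k + \<mu> (Tr(\<epsilon> z) - Q)\<close>, \<open>\<mu> \<in> K\<close>, of which the two
  given equations are members.\<close>

lemma card_circle_line_plus_dual:
  assumes m: "m \<in> K'" and K: "k \<in> K" "Q \<in> K" and e: "\<epsilon> \<noteq> 0"
  shows "int (card {z. tr (\<epsilon> * z) = Q \<and> m * nrm z + tr (z * l) + k = 0}) +
    int (card {\<mu> \<in> K. nrm (l + \<mu> * \<epsilon>) = m * (k - \<mu> * Q)}) = 2"
    (is "int ?n + int ?c = 2")
proof -
  define G where "G z = m * nrm z + tr (z * l) + k" for z
  have G: "G z \<in> K" for z using m K by (simp add: G_def)
  have "(\<Sum>\<mu>\<in>K. \<Sum>z\<in>UNIV. of_bool (G z + \<mu> * (tr (\<epsilon> * z) - Q) = 0)) =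
      (\<Sum>\<mu>\<in>K. int q + 1 - int q * of_bool (nrm (l + \<mu> * \<epsilon>) = m * (k - \<mu> * Q)))"
  proof (rule sum.cong[OF refl])
    fix \<mu> assume mu: "\<mu> \<in> K"
    have "G z + \<mu> * (tr (\<epsilon> * z) - Q) = m * nrm z + tr (z * (l + \<mu> * \<epsilon>)) + (k - \<mu> * Q)" for z
      using mu by (simp add: G_def tr_def algebra_simps)
    then show "(\<Sum>z\<in>UNIV. of_bool (G z + \<mu> * (tr (\<epsilon> * z) - Q) = 0)) =
        int q + 1 - int q * of_bool (nrm (l + \<mu> * \<epsilon>) = m * (k - \<mu> * Q))"
      using card_hermitian_circle[OF m, of "k - \<mu> * Q" "l + \<mu> * \<epsilon>"] mu K
      by (simp add: sum_of_bool_card)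
  qed
  also have "\<dots> = int q * (int q + 1) - int q * int ?c"
    by (simp add: sum_subtractf sum_of_bool_card flip: sum_distrib_left)
  finally have 1: "(\<Sum>\<mu>\<in>K. \<Sum>z\<in>UNIV. of_bool (G z + \<mu> * (tr (\<epsilon> * z) - Q) = 0)) =
      int q * (int q + 1) - int q * int ?c" .
  have "(\<Sum>\<mu>\<in>K. \<Sum>z\<in>UNIV. of_bool (G z + \<mu> * (tr (\<epsilon> * z) - Q) = 0)) =
      (\<Sum>z\<in>UNIV. \<Sum>\<mu>\<in>K. of_bool (G z + \<mu> * (tr (\<epsilon> * z) - Q) = 0))"
    by (rule sum.swap)
  \<comment> \<open>A point off the line \<open>tr (\<epsilon> * z) = Q\<close> lies on exactly one
    member of the pencil; a point on the line lies on all \<open>q\<close> of them or on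
    none.\<close>
  also have "\<dots> = (\<Sum>z\<in>UNIV. 1 - of_bool (tr (\<epsilon> * z) = Q) + int q * of_bool (tr (\<epsilon> * z) = Q \<and> G z = 0))"
  proof (rule sum.cong[OF refl])
    fix z
    show "(\<Sum>\<mu>\<in>K. of_bool (G z + \<mu> * (tr (\<epsilon> * z) - Q) = 0)) =
        1 - of_bool (tr (\<epsilon> * z) = Q) + int q * of_bool (tr (\<epsilon> * z) = Q \<and> G z = 0)"
    proof (cases "tr (\<epsilon> * z) = Q")
      case False
      then have "G z + \<mu> * (tr (\<epsilon> * z) - Q) = 0 \<longleftrightarrow> \<mu> = - G z / (tr (\<epsilon> * z) - Q)" for \<mu>
        by (simp add: field_simps eq_neg_iff_add_eq_0)
      moreover have "- G z / (tr (\<epsilon> * z) - Q) \<in> K" using G K by simp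
      ultimately show ?thesis using False by (simp add: of_bool_def sum.delta)
    qed simp
  qed
  also have "\<dots> = int q * int q - int (card {z. tr (\<epsilon> * z) = Q}) + int q * int ?n"
    by (simp add: sum.distrib sum_subtractf sum_of_bool_card G_def card_F power2_eq_square
        flip: sum_distrib_left)
  also have "\<dots> = int q * int q - int q + int q * int ?n"
    using card_tr_scaled_fibre[OF K(2) e] by simp
  finally have "int q * (int ?n + int ?c) = int q * 2"
    using 1 by (simp add: algebra_simps)
  then show ?thesis using q_pos by simp
qed

section \<open>Counts over the fibres of a Buekenhout--Metz set\<close>

lemma exists_trace_zero: "\<exists>\<epsilon>. \<epsilon> \<noteq> 0 \<and> cj \<epsilon> = - \<epsilon>"
proof -
  have "\<not> {x. tr x = 0} \<subseteq> {0}"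
  proof
    assume "{x. tr x = 0} \<subseteq> {0}"
    then have "card {x. tr x = 0} \<le> card {0::'a}" by (intro card_mono) auto
    then show False using card_tr_fibre[of 0] q_gt_1 by simp
  qed
  then obtain x where x: "tr x = 0" "x \<noteq> 0" by blast
  then have "cj x + x = 0" by (simp only: tr_def add.commute)
  then have "cj x = - x" by (rule add_eq_0_iff2[THEN iffD1])
  with x show ?thesis by blast
qed

text \<open>Without a \<open>nrm z\<close> term the equation is affine in \<open>r\<close> with
  slope \<open>\<tau> y\<close>: one solution if the slope is nonzero, otherwise 0 or
  \<open>q\<close>. The slope is an affine trace function of \<open>y\<close>, whose zeros number 0,
  \<open>q\<close> or \<open>q ^ 2\<close>.\<close>

lemma BM_count_tangent:
  fixes m1 m2 b c e :: 'a and f :: "'a \<Rightarrow> 'a"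
  assumes K: "m1 \<in> K" "m2 \<in> K"
  defines "g \<equiv> \<lambda>y z. tr (z * (b + c * cj y)) + (m1 + tr (e * y) + m2 * nrm y)"
  shows "(\<Sum>y\<in>UNIV. int (card {r \<in> K. g y (f y + r) = 0})) \<simeq> 0"
proof -
  define \<tau> where "\<tau> y = tr (b + c * cj y)" for y
  have "int (card {r \<in> K. g y (f y + r) = 0}) \<simeq> of_bool (\<tau> y \<noteq> 0)" for y
  proof -
    have g: "g y (f y + r) = g y (f y) + r * \<tau> y" if "r \<in> K" for r
      using that by (simp add: g_def \<tau>_def tr_def algebra_simps)
    have gK: "g y z \<in> K" for z using K by (simp add: g_def)
    show ?thesis
    proof (cases "\<tau> y = 0")
      case True
      then have "{r \<in> K. g y (f y + r) = 0} = (if g y (f y) = 0 then K else {})"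
        using g by auto
      then show ?thesis using True by (simp add: cong_q_dvd_iff)
    next
      case False
      define r0 where "r0 = - g y (f y) / \<tau> y"
      have "r0 \<in> K" unfolding r0_def using gK[of "f y"] by (simp add: \<tau>_def)
      moreover have "g y (f y + r) = 0 \<longleftrightarrow> r = r0" if "r \<in> K" for r
        unfolding g[OF that] r0_def using False by (simp add: field_simps eq_neg_iff_add_eq_0)
      ultimately have "{r \<in> K. g y (f y + r) = 0} = {r0}" by blast
      then show ?thesis using False by simp
    qed
  qed
  then have "(\<Sum>y\<in>UNIV. int (card {r \<in> K. g y (f y + r) = 0})) \<simeq> (\<Sum>y\<in>UNIV. of_bool (\<tau> y \<noteq> 0))"
    by (rule cong_q_sum)
  also have "\<dots> = (\<Sum>y\<in>UNIV. 1 - of_bool (tr (cj c * y) = - tr b))"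
  proof (intro sum.cong refl)
    fix y
    have "\<tau> y = tr (cj c * y) + tr b"
      by (simp add: \<tau>_def tr_def algebra_simps)
    then show "of_bool (\<tau> y \<noteq> 0) = (1 - of_bool (tr (cj c * y) = - tr b) :: int)"
      by (simp add: eq_neg_iff_add_eq_0)
  qed
  also have "\<dots> = int q * int q - int (card {y. tr (cj c * y) = - tr b})"
    by (simp add: sum_subtractf sum_of_bool_card card_F power2_eq_square)
  also have "\<dots> \<simeq> 0"
  proof (cases "c = 0")
    case True
    moreover have "tr 0 = 0" by (simp add: tr_def)
    ultimately have "{y. tr (cj c * y) = - tr b} = (if tr b = 0 then UNIV else {})"
      by auto
    then show ?thesis by (simp add: card_F cong_q_dvd_iff power2_eq_square)
  next
    case False
    then have "card {y. tr (cj c * y) = - tr b} = q"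
      by (intro card_tr_scaled_fibre) auto
    then show ?thesis by (simp add: cong_q_dvd_iff)
  qed
  finally show ?thesis .
qed

text \<open>For fixed \<open>y\<close> the values of \<open>z\<close> form the line
  \<open>tr (\<epsilon> * z) = Q y\<close>, and the pencil count replaces its intersection with the
  circle by 2 minus the number of dual parameters \<open>\<mu>\<close>. For fixed
  \<open>\<mu>\<close> the dual condition is an affine conic in \<open>y\<close>, which may be
  replaced by its quadratic part.\<close>

lemma BM_count_secant:
  fixes m1 m2 m3 b c e \<alpha> \<beta> :: 'a
  assumes K: "m1 \<in> K" "m2 \<in> K" and m: "m3 \<in> K'"
    and aniso: "\<And>y. \<alpha> * y ^ 2 + \<beta> * nrm y \<in> K \<Longrightarrow> y = 0"
  defines "g \<equiv> \<lambda>y z. m3 * nrm z + tr (z * (b + c * cj y)) + (m1 + tr (e * y) + m2 * nrm y)"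
  shows "(\<Sum>y\<in>UNIV. int (card {r \<in> K. g y (\<alpha> * y ^ 2 + \<beta> * nrm y + r) = 0})) \<simeq> 1"
proof -
  obtain \<epsilon> where eps: "\<epsilon> \<noteq> 0" "cj \<epsilon> = - \<epsilon>" using exists_trace_zero by blast
  have tr_eps: "tr (\<epsilon> * z) = 0 \<longleftrightarrow> z \<in> K" for z
  proof -
    have "tr (\<epsilon> * z) = \<epsilon> * (z - cj z)" using eps by (simp add: tr_def algebra_simps)
    then show ?thesis using eps(1) by (auto simp: mem_K_iff)
  qed
  define Q where "Q y = quad (\<epsilon> * \<alpha>) (tr (\<epsilon> * \<beta>)) y" for y
  have Q: "tr (\<epsilon> * (\<alpha> * y ^ 2 + \<beta> * nrm y)) = Q y" for y
    by (simp add: Q_def quad_def tr_def algebra_simps)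
  have Q_K: "Q y \<in> K" for y by (simp add: Q_def)
  \<comment> \<open>Anisotropy of \<open>Q\<close> is the hypothesis read through
    \<open>tr_eps\<close>.\<close>
  have Q_0: "Q y = 0 \<Longrightarrow> y = 0" for y by (metis aniso tr_eps Q)
  define l where "l y = b + c * cj y" for y
  define k where "k y = m1 + tr (e * y) + m2 * nrm y" for y
  have k_K: "k y \<in> K" for y using K by (simp add: k_def)
  define dual where "dual y = {\<mu> \<in> K. nrm (l y + \<mu> * \<epsilon>) = m3 * (k y - \<mu> * Q y)}" for y
  have fibre: "int (card {r \<in> K. g y (\<alpha> * y ^ 2 + \<beta> * nrm y + r) = 0}) = 2 - int (card (dual y))" for y
  proof -
    define z0 where "z0 = \<alpha> * y ^ 2 + \<beta> * nrm y"
    have g: "g y z = m3 * nrm z + tr (z * l y) + k y" for z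
      by (simp add: g_def l_def k_def)
    have tr_iff: "tr (\<epsilon> * z) = Q y \<longleftrightarrow> z - z0 \<in> K" for z
      unfolding tr_eps[symmetric] Q[symmetric] z0_def[symmetric] by (simp add: tr_def algebra_simps)
    have "bij_betw (\<lambda>r. z0 + r) {r \<in> K. g y (z0 + r) = 0} {z. z - z0 \<in> K \<and> g y z = 0}"
      by (rule bij_betw_byWitness[where f' = "\<lambda>z. z - z0"]) auto
    then have "bij_betw (\<lambda>r. z0 + r) {r \<in> K. g y (z0 + r) = 0}
        {z. tr (\<epsilon> * z) = Q y \<and> m3 * nrm z + tr (z * l y) + k y = 0}"
      unfolding g tr_iff .
    from bij_betw_same_card[OF this] show ?thesis
      using card_circle_line_plus_dual[OF m k_K[of y] Q_K[of y] eps(1), of "l y"]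
      unfolding dual_def z0_def[symmetric] by linarith
  qed
  \<comment> \<open>The quadratic part in \<open>y\<close> of the dual condition at
    \<open>\<mu>\<close> is \<open>s * nrm y + m3 * \<mu> * Q y\<close>.\<close>
  define s where "s = nrm c - m3 * m2"
  have dual_slice: "int (card {y. \<mu> \<in> K \<and> \<mu> \<in> dual y}) \<simeq> int (card {y. s * nrm y + m3 * \<mu> * Q y = 0})"
    if mu: "\<mu> \<in> K" for \<mu>
  proof -
    define k0 where "k0 = nrm (b + \<mu> * \<epsilon>) - m3 * m1"
    define k1 where "k1 = (b + \<mu> * \<epsilon>) * cj c - m3 * e"
    define k2 where "k2 = m3 * \<mu> * (\<epsilon> * \<alpha>)"
    define k3 where "k3 = s + m3 * \<mu> * tr (\<epsilon> * \<beta>)"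
    have cK: "cj m3 = m3" "cj \<mu> = \<mu>" "cj m2 = m2" using m mu K by auto
    have quad: "quad k2 k3 y = s * nrm y + m3 * \<mu> * Q y" for y
      using m mu tr_scale[of "m3 * \<mu>" "\<epsilon> * \<alpha> * y ^ 2"]
      by (simp add: quad_def Q_def k2_def k3_def algebra_simps)
    have "nrm (l y + \<mu> * \<epsilon>) - m3 * (k y - \<mu> * Q y) = k0 + tr (k1 * y) + quad k2 k3 y" for y
      unfolding quad k0_def k1_def l_def k_def s_def
      by (simp add: nrm_def tr_def cK algebra_simps)
    then have "\<mu> \<in> K \<and> \<mu> \<in> dual y \<longleftrightarrow> k0 + tr (k1 * y) + quad k2 k3 y = 0" for y
      using mu by (auto simp: dual_def) (metis eq_iff_diff_eq_0)+
    moreover have "k0 \<in> K" "k3 \<in> K" using m mu K by (simp_all add: k0_def k3_def s_def)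
    ultimately show ?thesis
      using card_affine_quad_zeros[of k0 k3 k1 k2] by (simp add: quad)
  qed
  have "(\<Sum>y\<in>UNIV. int (card (dual y))) = (\<Sum>y\<in>UNIV. \<Sum>\<mu>\<in>K. of_bool (\<mu> \<in> K \<and> \<mu> \<in> dual y))"
    by (intro sum.cong refl) (auto simp: sum_of_bool_card dual_def)
  also have "\<dots> = (\<Sum>\<mu>\<in>K. int (card {y. \<mu> \<in> K \<and> \<mu> \<in> dual y}))"
    by (subst sum.swap) (simp add: sum_of_bool_card)
  also have "\<dots> \<simeq> (\<Sum>\<mu>\<in>K. int (card {y. s * nrm y + m3 * \<mu> * Q y = 0}))"
    by (intro cong_q_sum dual_slice)
  also have "\<dots> = (\<Sum>\<mu>\<in>K. \<Sum>y\<in>UNIV. of_bool (s * nrm y + m3 * \<mu> * Q y = 0))"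
    by (simp add: sum_of_bool_card)
  also have "\<dots> = (\<Sum>y\<in>UNIV. \<Sum>\<mu>\<in>K. of_bool (s * nrm y + m3 * \<mu> * Q y = 0))"
    by (rule sum.swap)
  \<comment> \<open>After exchanging sums again the condition is linear in \<open>\<mu>\<close>:
    anisotropy gives exactly one solution for each \<open>y \<noteq> 0\<close>, while
    \<open>y = 0\<close> admits all \<open>q\<close> parameters.\<close>
  also have "\<dots> = (\<Sum>y\<in>(UNIV::'a set). 1 + (if y = 0 then int q - 1 else 0))"
  proof (rule sum.cong[OF refl])
    fix y
    show "(\<Sum>\<mu>\<in>K. of_bool (s * nrm y + m3 * \<mu> * Q y = 0)) = 1 + (if y = 0 then int q - 1 else 0)"
    proof (cases "y = 0")
      case True
      then show ?thesis by (simp add: Q_def quad_def tr_def)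
    next
      case False
      then have "Q y \<noteq> 0" using Q_0 by blast
      then have "s * nrm y + m3 * \<mu> * Q y = 0 \<longleftrightarrow> \<mu> = - (s * nrm y) / (m3 * Q y)" for \<mu>
        using m by (simp add: field_simps eq_neg_iff_add_eq_0)
      moreover have "- (s * nrm y) / (m3 * Q y) \<in> K" using m K Q_K by (simp add: s_def)
      ultimately show ?thesis using False by (simp add: of_bool_def sum.delta)
    qed
  qed
  also have "\<dots> = int q * int q + (int q - 1)"
    by (simp add: sum.distrib card_F power2_eq_square)
  also have "\<dots> \<simeq> - 1"
    by (simp add: cong_q_dvd_iff)
  finally have dual: "(\<Sum>y\<in>UNIV. int (card (dual y))) \<simeq> - 1" .
  have "(\<Sum>y\<in>UNIV. int (card {r \<in> K. g y (\<alpha> * y ^ 2 + \<beta> * nrm y + r) = 0})) =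
      2 * (int q * int q) - (\<Sum>y\<in>UNIV. int (card (dual y)))"
    by (simp only: fibre sum_subtractf sum_constant int_card_UNIV mult.commute)
  also have "\<dots> \<simeq> 0 - (- 1)"
    by (intro cong_q_diff dual) (simp add: cong_q_dvd_iff)
  finally show ?thesis by simp
qed

end

subsection \<open>Hermitian forms and unitals in the projective plane\<close>

lemma proj_pt_eqD:
  assumes "proj_pt v = proj_pt w"
  obtains c where "c \<noteq> 0" "w = c *s v"
proof -
  have "w \<in> proj_pt w" unfolding proj_pt_def by (auto intro!: exI[of _ 1])
  then have "w \<in> proj_pt v" by (simp only: assms)
  then have "\<exists>c. w = c *s v \<and> c \<noteq> 0" unfolding proj_pt_def by simp
  then show ?thesis using that by (elim exE conjE)
qed

lemma proj_pt_mem_proj_line: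
  assumes "v \<noteq> 0"
  shows "proj_pt v \<in> proj_line w \<longleftrightarrow> (\<Sum>i\<in>UNIV. w $ i * v $ i) = 0"
proof
  assume "proj_pt v \<in> proj_line w"
  then obtain u where u: "proj_pt v = proj_pt u" "(\<Sum>i\<in>UNIV. w $ i * u $ i) = 0"
    unfolding proj_line_def by blast
  from u(1)[symmetric] obtain c where "v = c *s u" by (rule proj_pt_eqD)
  then have "(\<Sum>i\<in>UNIV. w $ i * v $ i) = c * (\<Sum>i\<in>UNIV. w $ i * u $ i)"
    by (simp add: sum_distrib_left mult_ac)
  then show "(\<Sum>i\<in>UNIV. w $ i * v $ i) = 0" using u(2) by simp
qed (use assms in \<open>auto simp: proj_line_def\<close>)

context quadratic_extension
begin

section \<open>Hermitian forms and their diagonalisation\<close>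

lemma cj_sum: "cj (sum f A) = (\<Sum>x\<in>A. cj (f x))"
  by (induction A rule: infinite_finite_induct) auto

lemma herm_form_cj: "herm_form q M u v = (\<Sum>i\<in>UNIV. \<Sum>j\<in>UNIV. u $ i * M $ i $ j * cj (v $ j))"
  by (simp add: herm_form_def cj_def)

lemma herm_form_add_left:
  fixes M :: "'a^3^3"
  shows "herm_form q M (u + u') v = herm_form q M u v + herm_form q M u' v"
  by (simp add: herm_form_cj distrib_right sum.distrib)

lemma herm_form_diff_left:
  fixes M :: "'a^3^3"
  shows "herm_form q M (u - u') v = herm_form q M u v - herm_form q M u' v"
  by (simp add: herm_form_cj left_diff_distrib sum_subtractf)

lemma herm_form_scale_left:
  fixes M :: "'a^3^3"
  shows "herm_form q M (c *s u) v = c * herm_form q M u v"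
  by (simp add: herm_form_cj sum_distrib_left mult_ac)

lemma herm_form_add_right:
  fixes M :: "'a^3^3"
  shows "herm_form q M u (v + v') = herm_form q M u v + herm_form q M u v'"
  by (simp add: herm_form_cj distrib_left sum.distrib)

lemma herm_form_scale_right:
  fixes M :: "'a^3^3"
  shows "herm_form q M u (c *s v) = cj c * herm_form q M u v"
  by (simp add: herm_form_cj sum_distrib_left mult_ac)

lemma herm_form_0 [simp]:
  fixes M :: "'a^3^3"
  shows "herm_form q M 0 v = 0" "herm_form q M v 0 = 0"
  by (simp_all add: herm_form_cj)

lemmas herm_form_simps = herm_form_add_left herm_form_scale_left herm_form_add_right herm_form_scale_right

lemma cj_herm_form:
  fixes M :: "'a^3^3"
  assumes "is_hermitian_matrix q M"
  shows "cj (herm_form q M u v) = herm_form q M v u"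
proof -
  have "cj (M $ i $ j) = M $ j $ i" for i j
    unfolding cj_def by (rule assms[unfolded is_hermitian_matrix_def, rule_format, symmetric])
  then have "cj (herm_form q M u v) = (\<Sum>i\<in>UNIV. \<Sum>j\<in>UNIV. v $ j * M $ j $ i * cj (u $ i))"
    by (simp add: herm_form_cj cj_sum mult_ac)
  also have "\<dots> = herm_form q M v u"
    unfolding herm_form_cj by (rule sum.swap)
  finally show ?thesis .
qed

lemma herm_form_self_K: "is_hermitian_matrix q M \<Longrightarrow> herm_form q M v v \<in> K"
  unfolding mem_K_iff by (rule cj_herm_form)

lemma herm_form_nondegenerate:
  fixes M :: "'a^3^3"
  assumes "det M \<noteq> 0" and "\<And>v. herm_form q M u v = 0"
  shows "u = 0"
proof -
  have "(transpose M *v u) $ j = herm_form q M u (axis j 1)" for j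
  proof -
    have "herm_form q M u (axis j 1) = (\<Sum>i\<in>UNIV. \<Sum>k\<in>UNIV. if k = j then u $ i * M $ i $ k else 0)"
      unfolding herm_form_cj by (intro sum.cong refl) (auto simp: axis_def)
    also have "\<dots> = (\<Sum>i\<in>UNIV. u $ i * M $ i $ j)" by simp
    finally show ?thesis by (simp add: matrix_vector_mult_def transpose_def mult.commute)
  qed
  then have "transpose M *v u = 0" using assms(2) by (simp add: vec_eq_iff)
  moreover have "invertible (transpose M)" using assms(1) by (simp add: invertible_det_nz)
  ultimately show ?thesis
    using matrix_left_invertible_ker invertible_left_inverse by blast
qed

text \<open>Expanding leaves \<open>tr (herm_form q M v u * c) = 0\<close> for all \<open>c\<close>,
  but the trace of the multiples of a nonzero element takes the value 1. Using the trace instead of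
  division by 2 covers characteristic 2.\<close>

lemma herm_form_polarization:
  fixes M :: "'a^3^3"
  assumes M: "is_hermitian_matrix q M"
    and isotropic: "\<And>c. herm_form q M (u + c *s v) (u + c *s v) = 0"
    and v: "herm_form q M v v = 0"
  shows "herm_form q M u v = 0"
proof (rule ccontr)
  assume *: "herm_form q M u v \<noteq> 0"
  have vu: "herm_form q M v u = cj (herm_form q M u v)" by (simp add: cj_herm_form[OF M])
  have "tr (herm_form q M v u * c) = 0" for c
    using isotropic[of c] isotropic[of 0] v
    by (simp add: herm_form_simps vu tr_def algebra_simps)
  then have "{c. tr (herm_form q M v u * c) = 1} = {}" by simp
  moreover have "card {c. tr (herm_form q M v u * c) = 1} = q"
    using * by (intro card_tr_scaled_fibre) (auto simp: vu)
  ultimately show False using q_pos by simp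
qed

text \<open>Allowing \<open>v1 = 0\<close> or \<open>v2 = 0\<close> lets one statement serve all three steps of the
  orthogonalisation; division by zero makes the corresponding projection vanish.\<close>

lemma exists_orthogonal_anisotropic:
  fixes M :: "'a^3^3"
  assumes M: "is_hermitian_matrix q M" "det M \<noteq> 0"
    and v1: "v1 = 0 \<or> herm_form q M v1 v1 \<noteq> 0" and v2: "v2 = 0 \<or> herm_form q M v2 v2 \<noteq> 0"
    and orth: "herm_form q M v1 v2 = 0"
  shows "\<exists>u. herm_form q M u v1 = 0 \<and> herm_form q M u v2 = 0 \<and> herm_form q M u u \<noteq> 0"
proof (rule ccontr)
  assume neg: "\<not> ?thesis"
  have orth': "herm_form q M v2 v1 = 0"
    using cj_herm_form[OF M(1), of v1 v2] orth by simp
  define a where "a v i = (\<Sum>j\<in>UNIV. M $ i $ j * cj (v $ j))" for v and i :: 3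
  \<comment> \<open>The first two rows of \<open>A\<close> are the functionals pairing with
    \<open>v1\<close> and \<open>v2\<close>; the zero row makes \<open>A\<close> singular, which
    yields a common kernel vector.\<close>
  define A :: "'a^3^3" where "A = vector [\<chi> i. a v1 i, \<chi> i. a v2 i, 0]"
  have herm_a: "herm_form q M u v = (\<Sum>i\<in>UNIV. a v i * u $ i)" for u v
    by (simp add: herm_form_cj a_def sum_distrib_left sum_distrib_right mult_ac)
  have "row 3 A = 0" by (simp add: A_def row_def vec_eq_iff)
  then have "det A = 0" by (rule det_zero_row)
  then have "\<not> invertible A" by (simp add: invertible_det_nz)
  then obtain u0 where u0: "u0 \<noteq> 0" "A *v u0 = 0"
    using matrix_left_invertible_ker[of A] invertible_left_inverse[of A] by blast
  have u0_orth: "herm_form q M u0 v1 = 0" "herm_form q M u0 v2 = 0"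
  proof -
    have "(A *v u0) $ 1 = herm_form q M u0 v1" "(A *v u0) $ 2 = herm_form q M u0 v2"
      by (simp_all add: A_def matrix_vector_mult_def herm_a)
    then show "herm_form q M u0 v1 = 0" "herm_form q M u0 v2 = 0" using u0 by simp_all
  qed
  \<comment> \<open>If the orthogonal complement of \<open>v1\<close> and \<open>v2\<close> has no
    anisotropic vector, polarization makes \<open>u0\<close> orthogonal to all of it.\<close>
  have iso: "herm_form q M u0 u = 0" if "herm_form q M u v1 = 0" "herm_form q M u v2 = 0" for u
  proof (rule herm_form_polarization[OF M(1)])
    have *: "herm_form q M w w = 0" if "herm_form q M w v1 = 0" "herm_form q M w v2 = 0" for w
      using neg that by blast
    show "herm_form q M (u0 + c *s u) (u0 + c *s u) = 0" for c
      by (rule *) (simp_all add: herm_form_add_left herm_form_scale_left u0_orth that)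
    show "herm_form q M u u = 0" by (rule *) fact+
  qed
  \<comment> \<open>Subtracting the projections to \<open>v1\<close> and \<open>v2\<close> moves
    \<open>v\<close> into the complement, so \<open>u0\<close> lies in the radical.\<close>
  have "herm_form q M u0 v = 0" for v
  proof -
    define c1 where "c1 = herm_form q M v v1 / herm_form q M v1 v1"
    define c2 where "c2 = herm_form q M v v2 / herm_form q M v2 v2"
    define u where "u = v - (c1 *s v1 + c2 *s v2)"
    have "herm_form q M u v1 = 0" "herm_form q M u v2 = 0"
      unfolding u_def herm_form_diff_left herm_form_simps orth orth' c1_def c2_def
      using v1 v2 by auto
    then have "herm_form q M u0 u = 0" by (rule iso)
    moreover have "v = u + (c1 *s v1 + c2 *s v2)" by (simp add: u_def)
    ultimately show ?thesis
      by (simp add: herm_form_add_right herm_form_scale_right u0_orth)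
  qed
  then have "u0 = 0" by (rule herm_form_nondegenerate[OF M(2)])
  with u0 show False by simp
qed

text \<open>Three rounds of orthogonalisation give anisotropic, pairwise orthogonal columns of
  \<open>V\<close>; pairing \<open>V *v x\<close> with each column recovers its coefficient, hence
  \<open>V\<close> is invertible.\<close>

lemma herm_form_diagonalizable:
  fixes M :: "'a^3^3"
  assumes M: "is_hermitian_matrix q M" "det M \<noteq> 0"
  obtains V :: "'a^3^3" and d1 d2 d3 where "invertible V" "d1 \<in> K'" "d2 \<in> K'" "d3 \<in> K'"
    "\<And>x. herm_form q M (V *v x) (V *v x) = d1 * nrm (x $ 1) + d2 * nrm (x $ 2) + d3 * nrm (x $ 3)"
proof -
  let ?B = "herm_form q M"
  obtain v1 where v1: "?B v1 v1 \<noteq> 0"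
    using exists_orthogonal_anisotropic[OF M, of 0 0] by auto
  obtain v2 where v2: "?B v2 v1 = 0" "?B v2 v2 \<noteq> 0"
    using exists_orthogonal_anisotropic[OF M, of v1 0] v1 by auto
  have v12: "?B v1 v2 = 0" using cj_herm_form[OF M(1), of v2 v1] v2 by simp
  obtain v3 where v3: "?B v3 v1 = 0" "?B v3 v2 = 0" "?B v3 v3 \<noteq> 0"
    using exists_orthogonal_anisotropic[OF M, of v1 v2] v1 v2 v12 by blast
  have v13: "?B v1 v3 = 0" "?B v2 v3 = 0"
    using cj_herm_form[OF M(1), of v3 v1] cj_herm_form[OF M(1), of v3 v2] v3 by simp_all
  define V :: "'a^3^3" where "V = (\<chi> i j. (if j = 1 then v1 else if j = 2 then v2 else v3) $ i)"
  have V: "V *v x = x $ 1 *s v1 + (x $ 2 *s v2 + x $ 3 *s v3)" for x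
    by (simp add: V_def matrix_vector_mult_def sum_3 vec_eq_iff mult_ac)
  have "x = 0" if "V *v x = 0" for x
  proof -
    have "?B (V *v x) v = 0" for v using that by simp
    from this[of v1] this[of v2] this[of v3] have "x $ 1 = 0" "x $ 2 = 0" "x $ 3 = 0"
      unfolding V herm_form_simps using v1 v2 v3 v12 v13 by simp_all
    then show ?thesis by (simp add: vec_eq_iff forall_3)
  qed
  then have "invertible V" using matrix_left_invertible_ker invertible_left_inverse by blast
  moreover have "?B (V *v x) (V *v x) = ?B v1 v1 * nrm (x $ 1) + ?B v2 v2 * nrm (x $ 2) + ?B v3 v3 * nrm (x $ 3)" for x
    unfolding V herm_form_simps v2(1) v12 v3(1,2) v13 by (simp add: nrm_def algebra_simps)
  ultimately show ?thesis
    using that[of V "?B v1 v1" "?B v2 v2" "?B v3 v3"] v1 v2 v3 herm_form_self_K[OF M(1)] by blast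
qed

section \<open>The congruence for arbitrary unitals\<close>

definition herm_points :: "'a^3^3 \<Rightarrow> ('a^3) set set" where
  "herm_points M = {proj_pt v | v. v \<noteq> 0 \<and> herm_form q M v v = 0}"

lemma proj_pt_mem_herm_points:
  assumes "v \<noteq> 0"
  shows "proj_pt v \<in> herm_points M \<longleftrightarrow> herm_form q M v v = 0"
proof
  assume "proj_pt v \<in> herm_points M"
  then obtain u where u: "proj_pt v = proj_pt u" "herm_form q M u u = 0"
    unfolding herm_points_def by blast
  from u(1)[symmetric] obtain c where "v = c *s u" by (rule proj_pt_eqD)
  then show "herm_form q M v v = 0" using u(2) by (simp add: herm_form_simps)
qed (use assms in \<open>auto simp: herm_points_def\<close>)

lemma unital_finite: "is_unital q U \<Longrightarrow> finite U"
  unfolding is_unital_def by (metis add_is_0 card.infinite one_neq_zero)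

text \<open>A line misses \<open>q ^ 3\<close> or \<open>q ^ 3 - q\<close> points of a unital,
  independently of the chosen representatives.\<close>

lemma unital_line_complement:
  assumes U: "is_unital q U" and rep: "\<And>P. P \<in> U \<Longrightarrow> rep P \<noteq> 0 \<and> proj_pt (rep P) = P"
  shows "(\<Sum>P\<in>U. of_bool ((\<Sum>i\<in>UNIV. w $ i * rep P $ i) \<noteq> 0)) \<simeq> 0"
proof (cases "w = 0")
  case True
  then show ?thesis by simp
next
  case False
  have fin: "finite U" using U by (rule unital_finite)
  have "{P \<in> U. (\<Sum>i\<in>UNIV. w $ i * rep P $ i) \<noteq> 0} = U - proj_line w \<inter> U"
    using proj_pt_mem_proj_line rep by fastforce
  then have "(\<Sum>P\<in>U. of_bool ((\<Sum>i\<in>UNIV. w $ i * rep P $ i) \<noteq> 0)) = int (card (U - proj_line w \<inter> U))"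
    using fin by (simp add: sum_of_bool_card)
  also have "\<dots> = int (card U) - int (card (proj_line w \<inter> U))"
    using fin by (simp add: card_Diff_subset of_nat_diff card_mono)
  also have "\<dots> \<simeq> 0"
  proof -
    have "proj_line w \<in> proj_lines" using False by (auto simp: proj_lines_def)
    then have "card (proj_line w \<inter> U) = 1 \<or> card (proj_line w \<inter> U) = q + 1" "card U = q ^ 3 + 1"
      using U by (auto simp: is_unital_def)
    then show ?thesis by (auto simp: cong_q_dvd_iff power3_eq_cube)
  qed
  finally show ?thesis .
qed

text \<open>In the coordinates given by the inverse of \<open>V\<close> the points of
  \<open>U\<close> off the Hermitian curve are those counted by the diagonal form; the rest of the
  \<open>q ^ 3 + 1\<close> points form the intersection. The exponent is \<open>t / 2\<close>
  rounded up.\<close>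

lemma hermitian_inter_unital:
  fixes M :: "'a^3^3"
  assumes M: "is_hermitian_matrix q M" "det M \<noteq> 0" and U: "is_unital q U"
  shows "[card (herm_points M \<inter> U) = 1] (mod p ^ ((t + 1) div 2))"
proof -
  obtain V :: "'a^3^3" and d1 d2 d3 where V: "invertible V" and d: "d1 \<in> K'" "d2 \<in> K'" "d3 \<in> K'"
    and diag: "\<And>x. herm_form q M (V *v x) (V *v x) = d1 * nrm (x $ 1) + d2 * nrm (x $ 2) + d3 * nrm (x $ 3)"
    by (rule herm_form_diagonalizable[OF M]) (rule that)
  from V obtain N where VN: "V ** N = mat 1" unfolding invertible_def by blast
  define rep where "rep P = (SOME v. v \<noteq> 0 \<and> proj_pt v = P)" for P :: "('a^3) set"
  have rep: "rep P \<noteq> 0 \<and> proj_pt (rep P) = P" if "P \<in> U" for P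
  proof -
    have "P \<in> proj_points" using U that by (auto simp: is_unital_def)
    then have "\<exists>v. v \<noteq> 0 \<and> proj_pt v = P" by (auto simp: proj_points_def)
    then show ?thesis unfolding rep_def by (rule someI_ex)
  qed
  define x where "x P = N *v rep P" for P
  have Vx: "V *v x P = rep P" for P
    by (simp add: x_def matrix_vector_mul_assoc VN)
  have "meets_lines U (\<lambda>P. x P $ 1) (\<lambda>P. x P $ 2) (\<lambda>P. x P $ 3)"
    unfolding meets_lines_def
  proof (intro allI)
    fix w1 w2 w3
    \<comment> \<open>\<open>W\<close> is the transpose of \<open>N\<close> applied to
      \<open>w\<close>, so a line in the new coordinates is a line in the old ones.\<close>
    define W where "W = (\<chi> j. w1 * N $ 1 $ j + w2 * N $ 2 $ j + w3 * N $ 3 $ j)"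
    have "w1 * x P $ 1 + w2 * x P $ 2 + w3 * x P $ 3 = (\<Sum>i\<in>UNIV. W $ i * rep P $ i)" for P
      by (simp add: x_def W_def matrix_vector_mult_def sum_3 algebra_simps)
    then show "(\<Sum>P\<in>U. of_bool (w1 * x P $ 1 + w2 * x P $ 2 + w3 * x P $ 3 \<noteq> 0)) \<simeq> 0"
      using unital_line_complement[OF U rep, of W] by simp
  qed
  from diagonal_count_dvd[OF this d]
  have "int (p ^ ((t + 1) div 2)) dvd (\<Sum>P\<in>U. of_bool (herm_form q M (rep P) (rep P) \<noteq> 0))"
    by (simp only: diag[symmetric] Vx)
  also have "\<dots> = int (card (U - herm_points M \<inter> U))"
  proof -
    have "{P \<in> U. herm_form q M (rep P) (rep P) \<noteq> 0} = U - herm_points M \<inter> U"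
      using proj_pt_mem_herm_points rep by fastforce
    then show ?thesis using unital_finite[OF U] by (simp add: sum_of_bool_card)
  qed
  also have "\<dots> = int (card U) - int (card (herm_points M \<inter> U))"
    using unital_finite[OF U] by (simp add: card_Diff_subset of_nat_diff card_mono)
  also have "card U = q ^ 3 + 1" using U by (simp add: is_unital_def)
  finally have 1: "int (p ^ ((t + 1) div 2)) dvd int (q ^ 3) + (1 - int (card (herm_points M \<inter> U)))"
    by (simp add: algebra_simps)
  have "p ^ ((t + 1) div 2) dvd q"
    unfolding q_eq using t_pos by (intro le_imp_power_dvd) simp
  then have "p ^ ((t + 1) div 2) dvd q ^ 3" by (simp add: power3_eq_cube)
  then have "int (p ^ ((t + 1) div 2)) dvd int (q ^ 3)" by (simp only: of_nat_dvd_iff)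
  with 1 have "int (p ^ ((t + 1) div 2)) dvd 1 - int (card (herm_points M \<inter> U))"
    by (simp only: dvd_add_right_iff)
  then have "[int 1 = int (card (herm_points M \<inter> U))] (mod int (p ^ ((t + 1) div 2)))"
    by (simp add: cong_iff_dvd_diff)
  then show ?thesis unfolding cong_int_iff by (rule cong_sym)
qed

section \<open>The congruence for Buekenhout--Metz unitals\<close>

definition BM_pt :: "'a^3^3 \<Rightarrow> 'a \<Rightarrow> 'a \<Rightarrow> 'a \<times> 'a \<Rightarrow> ('a^3) set" where
  "BM_pt A \<alpha> \<beta> = (\<lambda>(y, r). proj_pt (A *v vector [1, y, \<alpha> * y ^ 2 + \<beta> * nrm y + r]))"

lemma BM_points_eq:
  "{proj_pt (A *v v) | v. v \<in> BM_vecs q \<alpha> \<beta>} =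
    insert (proj_pt (A *v vector [0, 0, 1])) (BM_pt A \<alpha> \<beta> ` (UNIV \<times> K))"
  unfolding BM_vecs_def BM_pt_def power_q_plus_1 K_def by (auto simp: image_iff)

lemma invertible_mult_eq_0:
  assumes "invertible (A::'a^3^3)"
  shows "A *v v = 0 \<longleftrightarrow> v = 0"
  using assms matrix_left_invertible_ker[of A] invertible_left_inverse[of A] by auto

lemma proj_pt_mult_eqD:
  assumes "invertible (A::'a^3^3)" "proj_pt (A *v v) = proj_pt (A *v w)"
  obtains c where "c \<noteq> 0" "w = c *s v"
proof -
  obtain c where c: "c \<noteq> 0" "A *v w = c *s (A *v v)" using assms(2) by (rule proj_pt_eqD)
  then have "A *v (w - c *s v) = 0"
    by (simp add: matrix_vector_mult_diff_distrib vector_scalar_commute)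
  then have "w = c *s v" using assms(1) by (simp add: invertible_mult_eq_0)
  with c(1) show ?thesis by (rule that)
qed

text \<open>The leading coordinate 1 fixes the scalar of a representative, so the parameters
  \<open>(y, r)\<close> are determined by the point; the special point has leading coordinate 0 and
  is not parametrised.\<close>

lemma card_inter_BM_points:
  assumes A: "invertible A"
  shows "card (S \<inter> insert (proj_pt (A *v vector [0, 0, 1])) (BM_pt A \<alpha> \<beta> ` (UNIV \<times> K))) =
    of_bool (proj_pt (A *v vector [0, 0, 1]) \<in> S) + (\<Sum>y\<in>UNIV. card {r \<in> K. BM_pt A \<alpha> \<beta> (y, r) \<in> S})"
proof -
  let ?Pinf = "proj_pt (A *v vector [0, 0, 1])"
  have inj: "inj_on (BM_pt A \<alpha> \<beta>) X" for X
  proof (rule inj_onI, clarify)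
    fix y r y' r' assume "BM_pt A \<alpha> \<beta> (y, r) = BM_pt A \<alpha> \<beta> (y', r')"
    then obtain c where "vector [1, y', \<alpha> * y' ^ 2 + \<beta> * nrm y' + r'] =
        c *s (vector [1, y, \<alpha> * y ^ 2 + \<beta> * nrm y + r] :: 'a^3)"
      unfolding BM_pt_def by (auto elim: proj_pt_mult_eqD[OF A])
    then have eq: "vector [1, y', \<alpha> * y' ^ 2 + \<beta> * nrm y' + r'] $ i =
        (c *s (vector [1, y, \<alpha> * y ^ 2 + \<beta> * nrm y + r] :: 'a^3)) $ i" for i
      by simp
    have r: "\<alpha> * y' ^ 2 + \<beta> * nrm y' + r' = c * (\<alpha> * y ^ 2 + \<beta> * nrm y + r)"
      using eq[of 3] by simp
    have "c = 1" "y' = c * y" using eq[of 1] eq[of 2] by simp_all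
    then have "c = 1" "y' = y" by simp_all
    then show "y = y' \<and> r = r'" using r by simp
  qed
  have notin: "?Pinf \<noteq> BM_pt A \<alpha> \<beta> z" for z
  proof
    assume eq: "?Pinf = BM_pt A \<alpha> \<beta> z"
    obtain y r where z: "z = (y, r)" by (cases z)
    from eq obtain c where "vector [1, y, \<alpha> * y ^ 2 + \<beta> * nrm y + r] = c *s (vector [0, 0, 1] :: 'a^3)"
      unfolding BM_pt_def z by (auto elim: proj_pt_mult_eqD[OF A])
    then show False by (simp add: vec_eq_iff forall_3)
  qed
  define T where "T = {z \<in> UNIV \<times> K. BM_pt A \<alpha> \<beta> z \<in> S}"
  have finT: "finite T" unfolding T_def by (rule finite_subset[of _ "UNIV \<times> K"]) auto
  have "S \<inter> insert ?Pinf (BM_pt A \<alpha> \<beta> ` (UNIV \<times> K)) =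
      (if ?Pinf \<in> S then insert ?Pinf (BM_pt A \<alpha> \<beta> ` T) else BM_pt A \<alpha> \<beta> ` T)"
    by (auto simp: T_def)
  moreover have "?Pinf \<notin> BM_pt A \<alpha> \<beta> ` T" using notin by blast
  ultimately have "card (S \<inter> insert ?Pinf (BM_pt A \<alpha> \<beta> ` (UNIV \<times> K))) = of_bool (?Pinf \<in> S) + card T"
    using finT by (simp add: card_image[OF inj])
  also have "T = (SIGMA y:UNIV. {r \<in> K. BM_pt A \<alpha> \<beta> (y, r) \<in> S})"
    by (auto simp: T_def)
  also have "card \<dots> = (\<Sum>y\<in>UNIV. card {r \<in> K. BM_pt A \<alpha> \<beta> (y, r) \<in> S})"
    by simp
  finally show ?thesis .
qed

text \<open>For \<open>q = 2\<close> the conclusion fails: there the quadratic form may be hyperbolic.\<close>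

lemma BM_unital_anisotropic:
  assumes A: "invertible A" and q: "q > 2"
    and U: "is_unital q (insert (proj_pt (A *v vector [0, 0, 1])) (BM_pt A \<alpha> \<beta> ` (UNIV \<times> K)))"
    and y: "\<alpha> * y ^ 2 + \<beta> * nrm y \<in> K"
  shows "y = 0"
proof (rule ccontr)
  assume y0: "y \<noteq> 0"
  define S where "S = {y. \<alpha> * y ^ 2 + \<beta> * nrm y \<in> K}"
  obtain N where N: "N ** A = mat 1" using A unfolding invertible_def by blast
  \<comment> \<open>The third row of \<open>N\<close> is the line on which the third coordinate
    before applying \<open>A\<close> vanishes. It avoids the special point and meets
    \<open>U\<close> in one point for each \<open>y\<close> in \<open>S\<close>, so its intersection
    number bounds \<open>S\<close>.\<close>
  have NA: "(\<Sum>i\<in>UNIV. N $ 3 $ i * (A *v v) $ i) = v $ 3" for v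
  proof -
    have "(\<Sum>i\<in>UNIV. N $ 3 $ i * (A *v v) $ i) = (N *v (A *v v)) $ 3"
      by (simp add: matrix_vector_mult_def)
    then show ?thesis by (simp add: matrix_vector_mul_assoc N)
  qed
  have "N $ 3 \<noteq> 0"
  proof
    assume "N $ 3 = 0"
    then show False using NA[of "vector [0, 0, 1]"] by simp
  qed
  then have "proj_line (N $ 3) \<in> proj_lines" by (auto simp: proj_lines_def)
  then have "card (proj_line (N $ 3) \<inter> insert (proj_pt (A *v vector [0, 0, 1])) (BM_pt A \<alpha> \<beta> ` (UNIV \<times> K)))
      \<in> {1, q + 1}"
    using U by (simp add: is_unital_def)
  also have "card (proj_line (N $ 3) \<inter> insert (proj_pt (A *v vector [0, 0, 1])) (BM_pt A \<alpha> \<beta> ` (UNIV \<times> K))) = card S"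
  proof -
    have inf: "(vector [0, 0, 1] :: 'a^3) \<noteq> 0" and fin: "(vector [1, y, z] :: 'a^3) \<noteq> 0" for y z
      by (auto simp: vec_eq_iff forall_3)
    have "card {r \<in> K. BM_pt A \<alpha> \<beta> (y, r) \<in> proj_line (N $ 3)} = of_bool (y \<in> S)" for y
    proof -
      have "{r \<in> K. BM_pt A \<alpha> \<beta> (y, r) \<in> proj_line (N $ 3)} = {r \<in> K. r = - (\<alpha> * y ^ 2 + \<beta> * nrm y)}"
        by (simp add: BM_pt_def proj_pt_mem_proj_line invertible_mult_eq_0[OF A] fin NA
            add_eq_0_iff)
      also have "\<dots> = (if y \<in> S then {- (\<alpha> * y ^ 2 + \<beta> * nrm y)} else {})"
      proof -
        have "- z \<in> K \<longleftrightarrow> z \<in> K" for z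
          using K_intros(9)[of z] K_intros(9)[of "- z"] by auto
        then have "y \<in> S \<longleftrightarrow> - (\<alpha> * y ^ 2 + \<beta> * nrm y) \<in> K" by (simp only: S_def mem_Collect_eq)
        moreover have "{r \<in> K. r = w} = (if w \<in> K then {w} else {})" for w by auto
        ultimately show ?thesis by (simp only:)
      qed
      finally show ?thesis by simp
    qed
    moreover have "proj_pt (A *v vector [0, 0, 1]) \<notin> proj_line (N $ 3)"
      by (simp add: proj_pt_mem_proj_line invertible_mult_eq_0[OF A] inf NA)
    ultimately show ?thesis
      unfolding card_inter_BM_points[OF A] by (simp add: of_bool_def sum.If_cases)
  qed
  finally have card_S: "card S = 1 \<or> card S = q + 1" by simp
  have scale: "s * z \<in> S" if "s \<in> K" "z \<in> S" for s z
  proof -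
    have "\<alpha> * (s * z) ^ 2 + \<beta> * nrm (s * z) = s * s * (\<alpha> * z ^ 2 + \<beta> * nrm z)"
      using that(1) by (simp add: nrm_def power2_eq_square algebra_simps)
    then show ?thesis using that by (simp add: S_def)
  qed
  have card_line: "card ((\<lambda>s. s * z) ` K) = q" if "z \<noteq> 0" for z
    using that by (subst card_image) (auto intro: inj_onI)
  \<comment> \<open>A nonzero \<open>y\<close> brings the whole \<open>K\<close>-line through it
    into \<open>S\<close>, which leaves only the size \<open>q + 1\<close> and hence an element
    outside that line.\<close>
  have "(\<lambda>s. s * y) ` K \<subseteq> S" using scale y by (auto simp: S_def)
  then have "card S = q + 1" and "\<not> S \<subseteq> (\<lambda>s. s * y) ` K"
    using card_S card_line[OF y0] card_mono[of S "(\<lambda>s. s * y) ` K"] card_mono[of "(\<lambda>s. s * y) ` K" S] q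
    by auto
  then obtain z where z: "z \<in> S" "z \<notin> (\<lambda>s. s * y) ` K" by blast
  then have "z \<noteq> 0" by (metis K_intros(1) image_eqI mult_zero_left)
  have "(\<lambda>s. s * y) ` K \<inter> (\<lambda>s. s * z) ` K \<subseteq> {0}"
  proof clarify
    fix s s' assume s: "s \<in> K" "s' \<in> K" "s * y = s' * z"
    show "s * y = 0"
    proof (rule ccontr)
      assume "s * y \<noteq> 0"
      then have "z = (s / s') * y" using s by (auto simp: field_simps)
      moreover have "s / s' \<in> K" using s by simp
      ultimately show False using z(2) by blast
    qed
  qed
  \<comment> \<open>Two \<open>K\<close>-lines meeting only in 0 have \<open>2 * q - 1\<close>
    elements together, which exceeds \<open>q + 1\<close> for \<open>q > 2\<close>.\<close>
  then have "card ((\<lambda>s. s * y) ` K \<inter> (\<lambda>s. s * z) ` K) \<le> card {0::'a}"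
    by (intro card_mono) auto
  moreover have "card ((\<lambda>s. s * y) ` K \<union> (\<lambda>s. s * z) ` K) \<le> card S"
    using scale y z by (intro card_mono) (auto simp: S_def)
  moreover have "card ((\<lambda>s. s * y) ` K) + card ((\<lambda>s. s * z) ` K) =
      card ((\<lambda>s. s * y) ` K \<union> (\<lambda>s. s * z) ` K) + card ((\<lambda>s. s * y) ` K \<inter> (\<lambda>s. s * z) ` K)"
    by (rule card_Un_Int) auto
  ultimately show False
    using card_line[OF y0] card_line[OF \<open>z \<noteq> 0\<close>] \<open>card S = q + 1\<close> q by simp
qed

text \<open>Pulled back through \<open>A\<close>, the Hermitian equation has \<open>nrm z\<close>
  with coefficient the form at the image of the special point. Whether that point lies on the curve
  decides between the two counts; the special point then supplies the 1 in the first case, the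
  affine points in the second.\<close>

lemma hermitian_inter_BM_unital:
  fixes M :: "'a^3^3"
  assumes M: "is_hermitian_matrix q M" and q: "q > 2" and U: "is_BM_unital q U"
  shows "[card (herm_points M \<inter> U) = 1] (mod q)"
proof -
  obtain \<alpha> \<beta> A where A: "invertible A" and U_eq: "U = {proj_pt (A *v v) | v. v \<in> BM_vecs q \<alpha> \<beta>}"
    and unital: "is_unital q U"
    using U unfolding is_BM_unital_def by blast
  let ?B = "herm_form q M"
  \<comment> \<open>\<open>a i\<close> is the column \<open>i\<close> of \<open>A\<close>;
    \<open>a 3\<close> represents the special point.\<close>
  define a where "a i = (\<chi> k. A $ k $ i)" for i
  have A_vec: "A *v v = v $ 1 *s a 1 + (v $ 2 *s a 2 + v $ 3 *s a 3)" for v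
    by (simp add: a_def matrix_vector_mult_def sum_3 vec_eq_iff mult_ac)
  define g where "g y z = ?B (a 3) (a 3) * nrm z + tr (z * (?B (a 3) (a 1) + ?B (a 3) (a 2) * cj y)) +
      (?B (a 1) (a 1) + tr (?B (a 2) (a 1) * y) + ?B (a 2) (a 2) * nrm y)" for y z
  have flip: "?B (a i) (a j) = cj (?B (a j) (a i))" for i j
    by (simp add: cj_herm_form[OF M])
  have g: "?B (A *v vector [1, y, z]) (A *v vector [1, y, z]) = g y z" for y z
    unfolding A_vec g_def herm_form_simps
    by (simp add: flip[of 1 2] flip[of 1 3] flip[of 2 3] nrm_def tr_def algebra_simps)
  have inf: "(vector [0, 0, 1] :: 'a^3) \<noteq> 0" and fin: "(vector [1, y, z] :: 'a^3) \<noteq> 0" for y z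
    by (auto simp: vec_eq_iff forall_3)
  have BK: "?B v v \<in> K" for v by (rule herm_form_self_K[OF M])
  have "int (card (herm_points M \<inter> U)) = of_bool (?B (a 3) (a 3) = 0) +
      (\<Sum>y\<in>UNIV. int (card {r \<in> K. g y (\<alpha> * y ^ 2 + \<beta> * nrm y + r) = 0}))"
  proof -
    have "proj_pt (A *v vector [0, 0, 1]) \<in> herm_points M \<longleftrightarrow> ?B (a 3) (a 3) = 0"
      by (simp add: proj_pt_mem_herm_points invertible_mult_eq_0[OF A] inf) (simp add: A_vec)
    moreover have "BM_pt A \<alpha> \<beta> (y, r) \<in> herm_points M \<longleftrightarrow> g y (\<alpha> * y ^ 2 + \<beta> * nrm y + r) = 0" for y r
      by (simp add: BM_pt_def proj_pt_mem_herm_points invertible_mult_eq_0[OF A] fin g)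
    ultimately show ?thesis
      unfolding U_eq BM_points_eq card_inter_BM_points[OF A] by simp
  qed
  also have "\<dots> \<simeq> 1"
  proof (cases "?B (a 3) (a 3) = 0")
    case True
    have "(\<Sum>y\<in>UNIV. int (card {r \<in> K. g y (\<alpha> * y ^ 2 + \<beta> * nrm y + r) = 0})) \<simeq> 0"
      unfolding g_def True mult_zero_left add_0_left by (rule BM_count_tangent[OF BK BK])
    from cong_q_add[OF cong_q_refl[of 1] this] show ?thesis using True by simp
  next
    case False
    have "y = 0" if "\<alpha> * y ^ 2 + \<beta> * nrm y \<in> K" for y
      using BM_unital_anisotropic[OF A q _ that] unital unfolding U_eq BM_points_eq by blast
    then have "(\<Sum>y\<in>UNIV. int (card {r \<in> K. g y (\<alpha> * y ^ 2 + \<beta> * nrm y + r) = 0})) \<simeq> 1"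
      unfolding g_def using False by (intro BM_count_secant) (auto simp: BK)
    then show ?thesis using False by simp
  qed
  finally have "[int (card (herm_points M \<inter> U)) = int 1] (mod int q)" by (simp add: cong_q_def)
  then show ?thesis unfolding cong_int_iff .
qed

end

section \<open>Combination of the two congruences\<close>

theorem theorem1:
  fixes H U :: "('a::{finite,field} ^ 3) set set"
    and p t q :: nat
  assumes "prime p" and "t \<ge> 1" and "q = p ^ t"
    and "CARD('a) = q ^ 2"
    and "is_hermitian_unital q H"
    and "is_unital q U"
    and "U \<noteq> H"
  shows "[card (H \<inter> U) = 1] (mod p ^ ((t + 1) div 2)) \<and>
         (is_BM_unital q U \<longrightarrow> [card (H \<inter> U) = 1] (mod q))"
proof -
  interpret quadratic_extension p t q "TYPE('a)"
    using assms by unfold_locales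
  from assms(5) obtain M where M: "is_hermitian_matrix q M" "det M \<noteq> 0" and H: "H = herm_points M"
    unfolding is_hermitian_unital_def herm_points_def by blast
  have 1: "[card (H \<inter> U) = 1] (mod p ^ ((t + 1) div 2))"
    unfolding H by (rule hermitian_inter_unital[OF M assms(6)])
  have "[card (H \<inter> U) = 1] (mod q)" if "is_BM_unital q U"
  proof (cases "t = 1")
    case True
    \<comment> \<open>For \<open>t = 1\<close> the exponent \<open>(t + 1) div 2\<close> is 1, so
      the first congruence is already modulo \<open>q\<close>; this settles \<open>q = 2\<close>,
      where anisotropy may fail.\<close>
    then show ?thesis using 1 by (simp add: assms(3))
  next
    case False
    have "p ^ 2 dvd q" unfolding assms(3) using False assms(2) by (intro le_imp_power_dvd) simp
    then have "p ^ 2 \<le> q" using q_pos by (rule dvd_imp_le)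
    moreover have "p ^ 2 > 2"
      using prime_ge_2_nat[OF assms(1)] power_mono[of 2 p 2] by simp
    ultimately have "q > 2" by linarith
    then show ?thesis unfolding H by (rule hermitian_inter_BM_unital[OF M(1) _ that])
  qed
  with 1 show ?thesis by blast
qed

end
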